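(* Let $G$ be a connected graph on $n$ vertices, $v\in V_G$ and $U\subseteq N_G(v)$. Then there is at most one graph $H$ containing no cycle of length $3$ and no cycle of length $5$ such that $H^2=G$ and $N_H(v)=U$. Moreover, this unique graph $H$, if it exists, can be constructed (or its non-existence reported) in time $O(M(n))$.
   Context: All graphs are finite, undirected and simple. For a graph $H$, $H^2$ is the graph on the same vertex set in which two distinct vertices are adjacent iff their distance in $H$ is at most $2$. $N_G(v)$ denotes the neighbourhood of $v$ in $G$. $M(n)$ denotes the time needed to multiply two $n\times n$ matrices. *)

theory Defs
  imports
    "Graph_Theory.Graph_Theory"
    "Jordan_Normal_Form.Matrix"
    "HOL-Library.Landau_Symbols"
begin

section \<open>Graphs, squares and square roots\<close>

text \<open>
  A finite simple undirected graph is a \<^locale>\<open>pair_graph\<close>: a finite, loop-free, symmetric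
  digraph, whose arcs are ordered pairs of vertices.
\<close>

definition neighbourhood :: "'a pair_pre_digraph \<Rightarrow> 'a \<Rightarrow> 'a set" where
  "neighbourhood G v = {w. (v, w) \<in> parcs G}"

text \<open>The distance is the library's shortest-path distance for unit arc weights.\<close>

definition graph_square :: "'a pair_pre_digraph \<Rightarrow> 'a pair_pre_digraph" where
  "graph_square H = \<lparr> pverts = pverts H,
     parcs = {(x, y). x \<in> pverts H \<and> y \<in> pverts H \<and> x \<noteq> y \<and>
                      wf_digraph.\<mu> (with_proj H) (\<lambda>_. 1) x y \<le> 2} \<rparr>"

text \<open>
  Directed cycles of length at least 3 in a symmetric digraph are exactly the cycles of the
  underlying undirected graph (traversed in some direction from some starting point).
\<close>

definition has_cycle_of_length :: "'a pair_pre_digraph \<Rightarrow> nat \<Rightarrow> bool" where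
  "has_cycle_of_length H l \<longleftrightarrow> (\<exists>p. pre_digraph.cycle (with_proj H) p \<and> length p = l)"

definition C3_C5_free_root_at ::
    "'a pair_pre_digraph \<Rightarrow> 'a \<Rightarrow> 'a set \<Rightarrow> 'a pair_pre_digraph \<Rightarrow> bool" where
  "C3_C5_free_root_at G v U H \<longleftrightarrow>
     pair_graph H \<and> \<not> has_cycle_of_length H 3 \<and> \<not> has_cycle_of_length H 5 \<and>
     graph_square H = G \<and> neighbourhood H v = U"

section \<open>Programs for a word RAM\<close>

text \<open>
  Running times refer to a unit-cost word RAM, programmed in a structured language. The memory
  consists of banks of integer cells with indirect addressing. A program text mentions only
  finitely many banks, so interleaving them gives an ordinary single-memory RAM with constant
  overhead.
\<close>

type_synonym memory = "nat \<Rightarrow> int \<Rightarrow> int"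

datatype expr =
    Const int
  | Read nat expr
  | Add expr expr
  | Sub expr expr
  | Mul expr expr
  | Div expr expr

datatype prog =
    Skip
  | Write nat expr expr
  | Seq prog prog
  | IfLess expr expr prog prog
  | WhileLess expr expr prog

primrec eval_expr :: "memory \<Rightarrow> expr \<Rightarrow> int" where
  "eval_expr s (Const c) = c"
| "eval_expr s (Read X a) = s X (eval_expr s a)"
| "eval_expr s (Add a b) = eval_expr s a + eval_expr s b"
| "eval_expr s (Sub a b) = eval_expr s a - eval_expr s b"
| "eval_expr s (Mul a b) = eval_expr s a * eval_expr s b"
| "eval_expr s (Div a b) = eval_expr s a div eval_expr s b"

primrec expr_time :: "expr \<Rightarrow> nat" where
  "expr_time (Const c) = 1"
| "expr_time (Read X a) = 1 + expr_time a"
| "expr_time (Add a b) = 1 + expr_time a + expr_time b"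
| "expr_time (Sub a b) = 1 + expr_time a + expr_time b"
| "expr_time (Mul a b) = 1 + expr_time a + expr_time b"
| "expr_time (Div a b) = 1 + expr_time a + expr_time b"

text \<open>
  Every value that arises during an evaluation, intermediate results and addresses included,
  must have absolute value at most \<open>W\<close>.
\<close>

primrec fits :: "int \<Rightarrow> memory \<Rightarrow> expr \<Rightarrow> bool" where
  "fits W s (Const c) \<longleftrightarrow> \<bar>c\<bar> \<le> W"
| "fits W s (Read X a) \<longleftrightarrow> fits W s a \<and> \<bar>s X (eval_expr s a)\<bar> \<le> W"
| "fits W s (Add a b) \<longleftrightarrow> fits W s a \<and> fits W s b \<and> \<bar>eval_expr s a + eval_expr s b\<bar> \<le> W"
| "fits W s (Sub a b) \<longleftrightarrow> fits W s a \<and> fits W s b \<and> \<bar>eval_expr s a - eval_expr s b\<bar> \<le> W"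
| "fits W s (Mul a b) \<longleftrightarrow> fits W s a \<and> fits W s b \<and> \<bar>eval_expr s a * eval_expr s b\<bar> \<le> W"
| "fits W s (Div a b) \<longleftrightarrow> fits W s a \<and> fits W s b \<and> \<bar>eval_expr s a div eval_expr s b\<bar> \<le> W"

text \<open>
  \<open>exec W p s t s'\<close>: started in memory \<open>s\<close>, the program \<open>p\<close> halts after \<open>t\<close> steps with memory
  \<open>s'\<close>, without exceeding the word bound \<open>W\<close>. A program that overflows is stuck, i.e. related to
  no final memory.
\<close>

inductive exec :: "int \<Rightarrow> prog \<Rightarrow> memory \<Rightarrow> nat \<Rightarrow> memory \<Rightarrow> bool" for W :: int where
  Skip: "exec W Skip s 1 s"
| Write: "fits W s a \<Longrightarrow> fits W s e \<Longrightarrow>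
    exec W (Write X a e) s (1 + expr_time a + expr_time e)
      (s(X := (s X)(eval_expr s a := eval_expr s e)))"
| Seq: "exec W p s t s' \<Longrightarrow> exec W q s' t' s'' \<Longrightarrow> exec W (Seq p q) s (1 + t + t') s''"
| IfTrue: "fits W s a \<Longrightarrow> fits W s b \<Longrightarrow> eval_expr s a < eval_expr s b \<Longrightarrow> exec W p s t s' \<Longrightarrow>
    exec W (IfLess a b p q) s (1 + expr_time a + expr_time b + t) s'"
| IfFalse: "fits W s a \<Longrightarrow> fits W s b \<Longrightarrow> \<not> eval_expr s a < eval_expr s b \<Longrightarrow> exec W q s t s' \<Longrightarrow>
    exec W (IfLess a b p q) s (1 + expr_time a + expr_time b + t) s'"
| WhileFalse: "fits W s a \<Longrightarrow> fits W s b \<Longrightarrow> \<not> eval_expr s a < eval_expr s b \<Longrightarrow>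
    exec W (WhileLess a b p) s (1 + expr_time a + expr_time b) s"
| WhileTrue: "fits W s a \<Longrightarrow> fits W s b \<Longrightarrow> eval_expr s a < eval_expr s b \<Longrightarrow>
    exec W p s t s' \<Longrightarrow> exec W (WhileLess a b p) s' t' s'' \<Longrightarrow>
    exec W (WhileLess a b p) s (1 + expr_time a + expr_time b + t + t') s''"

text \<open>
  Words of \<open>O(log n)\<close> bits: for inputs of dimension \<open>n\<close>, the word bound is a polynomial in \<open>n\<close>,
  whose exponent \<open>k\<close> may depend on the program but not on the input.
\<close>

definition word_bound :: "nat \<Rightarrow> nat \<Rightarrow> int" where
  "word_bound k n = (int n + 2) ^ k"

section \<open>The two computational problems\<close>

text \<open>Matrices are stored in row-major order; all cells that hold no input are initially zero.\<close>

definition matrix_bank :: "nat \<Rightarrow> int mat \<Rightarrow> int \<Rightarrow> int" where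
  "matrix_bank n A a =
     (if 0 \<le> a \<and> a < int (n * n) then A $$ (nat a div n, nat a mod n) else 0)"

definition bank_holds :: "nat \<Rightarrow> int mat \<Rightarrow> (int \<Rightarrow> int) \<Rightarrow> bool" where
  "bank_holds n A m \<longleftrightarrow> (\<forall>i<n. \<forall>j<n. m (int (i * n + j)) = A $$ (i, j))"

definition mult_input :: "nat \<Rightarrow> int mat \<Rightarrow> int mat \<Rightarrow> memory" where
  "mult_input n A B = (\<lambda>_ _. 0)
     (0 := (\<lambda>_. 0)(0 := int n), 1 := matrix_bank n A, 2 := matrix_bank n B)"

text \<open>
  \<open>P\<close> multiplies any two \<open>n \<times> n\<close> integer matrices with entries of absolute value at most
  \<open>n ^ d\<close> in at most \<open>M n\<close> steps, leaving the product in bank 3.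
\<close>

definition multiplies_matrices :: "nat \<Rightarrow> prog \<Rightarrow> (nat \<Rightarrow> nat) \<Rightarrow> bool" where
  "multiplies_matrices d P M \<longleftrightarrow>
     (\<exists>k. \<forall>n. \<forall>A \<in> carrier_mat n n. \<forall>B \<in> carrier_mat n n.
        (\<forall>i<n. \<forall>j<n. \<bar>A $$ (i, j)\<bar> \<le> int n ^ d \<and> \<bar>B $$ (i, j)\<bar> \<le> int n ^ d) \<longrightarrow>
        (\<exists>t s. exec (word_bound k n) P (mult_input n A B) t s \<and> t \<le> M n \<and>
               bank_holds n (A * B) (s 3)))"

definition adjacency_matrix :: "nat \<Rightarrow> nat pair_pre_digraph \<Rightarrow> int mat" where
  "adjacency_matrix n G = mat n n (\<lambda>(i, j). of_bool ((i, j) \<in> parcs G))"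

definition root_input :: "nat \<Rightarrow> nat pair_pre_digraph \<Rightarrow> nat \<Rightarrow> nat set \<Rightarrow> memory" where
  "root_input n G v U = (\<lambda>_ _. 0)
     (0 := (\<lambda>_. 0)(0 := int n, 1 := int v),
      1 := matrix_bank n (adjacency_matrix n G),
      2 := (\<lambda>a. of_bool (0 \<le> a \<and> nat a \<in> U)))"

text \<open>
  Graphs with \<open>n\<close> vertices are presented to a program by their adjacency matrix, the vertices
  being numbered from \<open>0\<close> to \<open>n - 1\<close>. Cell 0 of bank 4 reports whether a root exists (1) or
  not (0); in the first case bank 3 contains the adjacency matrix of the root.
\<close>

definition constructs_roots :: "prog \<Rightarrow> (nat \<Rightarrow> nat) \<Rightarrow> bool" where
  "constructs_roots Q T \<longleftrightarrow>
     (\<exists>k. \<forall>n G v U.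
        pair_graph G \<and> pverts G = {..<n} \<and> Digraph_Component.connected (with_proj G) \<and>
        v \<in> pverts G \<and> U \<subseteq> neighbourhood G v \<longrightarrow>
        (\<exists>t s. exec (word_bound k n) Q (root_input n G v U) t s \<and> t \<le> T n \<and>
          (\<forall>H. C3_C5_free_root_at G v U H \<longrightarrow>
             s 4 0 = 1 \<and> bank_holds n (adjacency_matrix n H) (s 3)) \<and>
          ((\<nexists>H. C3_C5_free_root_at G v U H) \<longrightarrow> s 4 0 = 0)))"

end

theory Submission
  imports Defs
begin

text \<open>
  In a root \<open>H\<close> without cycles of length 3 and 5, the neighbourhood of a vertex \<open>p\<close> determines that of
  each neighbour \<open>u\<close> of \<open>p\<close>: besides \<open>p\<close>, it consists of the common neighbours of \<open>u\<close> and \<open>p\<close> in \<open>H\<^sup>2\<close>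
  that are not neighbours of \<open>p\<close> in \<open>H\<close>. Indeed, if such a vertex were not adjacent to \<open>u\<close>, then paths of
  length 2 to \<open>p\<close> and to \<open>u\<close> would close a 5-cycle with the edge \<open>pu\<close>. Since \<open>H\<close> is connected, the root
  is unique, and a breadth-first search from \<open>v\<close> recovers its only candidate in time \<open>O(n\<^sup>2)\<close>.

  Let \<open>A\<close> be the candidate's adjacency matrix and \<open>B\<close> the 0-1 support of \<open>A\<^sup>2\<close>. The candidate is a root
  iff \<open>A\<close> is symmetric, \<open>A + B\<close> agrees with the adjacency matrix of \<open>G\<close> off the diagonal, and the
  supports of \<open>A\<^sup>2\<close> and \<open>B\<^sup>2\<close> are both disjoint from that of \<open>A\<close>, which excludes closed walks of length 3
  and 5. So two multiplications suffice, and \<open>n\<^sup>2\<close> is \<open>O(M(n))\<close> because a multiplication program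
  must write all entries of the product of two all-ones matrices.
\<close>

section \<open>Square roots without short cycles\<close>

text \<open>The program must halt with a correct verdict on inputs that have no root, and the search
  cannot recognise them. Its invariants therefore have two halves: an unconditional one that bounds
  values, and one relative to an arbitrary relation with the properties of a root. Whatever matrix
  the search leaves is then judged as it stands. The multiplication program is a black box. It is
  trusted only on entries of size at most \<open>n ^ d\<close>, where \<open>d\<close> may be 0, so
  only 0-1 matrices can safely be passed to it; this is why the support \<open>B\<close>, and not
  \<open>A\<^sup>2\<close> itself, is squared. It may also destroy its operands and use any banks,
  so each call runs on a renamed copy with banks of its own. An overflow leaves a program without a
  final memory, so every intermediate value is a proof obligation.\<close>

lemma graph_square_verts [simp]: "pverts (graph_square H) = pverts H"
  by (simp add: graph_square_def)

lemma pair_graph_symD: "pair_graph H \<Longrightarrow> (x, y) \<in> parcs H \<Longrightarrow> (y, x) \<in> parcs H"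
  using pair_sym_digraph.arcs_symmetric pair_bidirected_digraph.axioms(1)
    pair_graph.axioms(2) pair_pseudo_graph.axioms(2) by metis

lemma pair_graph_irreflD: "pair_graph H \<Longrightarrow> (x, x) \<notin> parcs H"
  by (metis pair_digraph_def pair_graph_def pair_loopfree_digraph.no_loops')

lemma pair_graph_wfD:
  assumes "pair_graph H" "(x, y) \<in> parcs H"
  shows "x \<in> pverts H" "y \<in> pverts H"
proof -
  interpret pair_graph H by fact
  show "x \<in> pverts H" "y \<in> pverts H" using assms(2) by (auto dest: wellformed')
qed

lemma graph_square_arcs:
  assumes "pair_graph H"
  shows "(x, y) \<in> parcs (graph_square H) \<longleftrightarrow>
    x \<noteq> y \<and> ((x, y) \<in> parcs H \<or> (\<exists>z. (x, z) \<in> parcs H \<and> (z, y) \<in> parcs H))"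
proof -
  interpret pair_graph H by fact
  have cost: "awalk_cost (\<lambda>_. 1) p = real (length p)" for p :: "('a \<times> 'a) list"
    by (simp add: awalk_cost_def sum_list_triv)
  have *: "\<mu> (\<lambda>_. 1) x y \<le> 2 \<longleftrightarrow> (x, y) \<in> parcs H \<or> (\<exists>z. (x, z) \<in> parcs H \<and> (z, y) \<in> parcs H)"
    if xy: "x \<in> pverts H" "y \<in> pverts H" "x \<noteq> y"
  proof
    assume le: "\<mu> (\<lambda>_. 1) x y \<le> 2"
    \<comment> \<open>The distance is an infimum; the strict bound yields a walk as witness, and
      integrality of lengths brings 3 back to 2.\<close>
    have "\<mu> (\<lambda>_. 1) x y < 3" using le by (rule order_le_less_trans) simp
    then obtain p where p: "awalk x p y" "ereal (real (length p)) < 3"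
      unfolding \<mu>_def cost by (auto simp: INF_less_iff)
    then have "real (length p) < 3" by simp
    then have "length p < 3" by linarith
    then consider "p = []" | e where "p = [e]" | e f where "p = [e, f]"
      by (auto simp: numeral_3_eq_3 less_Suc_eq length_Suc_conv)
    then show "(x, y) \<in> parcs H \<or> (\<exists>z. (x, z) \<in> parcs H \<and> (z, y) \<in> parcs H)"
      using p(1) \<open>x \<noteq> y\<close> by cases (auto simp: awalk_def)
  next
    assume "(x, y) \<in> parcs H \<or> (\<exists>z. (x, z) \<in> parcs H \<and> (z, y) \<in> parcs H)"
    then obtain p where p: "awalk x p y" "length p \<le> 2"
    proof (elim disjE exE conjE)
      assume "(x, y) \<in> parcs H" then show ?thesis
        using xy(1,2) by (intro that[of "[(x, y)]"]) (auto simp: awalk_def dest: wellformed')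
    next
      fix z assume "(x, z) \<in> parcs H" "(z, y) \<in> parcs H" then show ?thesis
        by (intro that[of "[(x, z), (z, y)]"]) (auto simp: awalk_def dest: wellformed')
    qed
    have "\<mu> (\<lambda>_. 1) x y \<le> ereal (real (length p))"
      using min_cost_le_walk_cost[OF p(1), of "\<lambda>_. 1"] by (simp add: cost)
    also have "\<dots> \<le> 2" using p(2) by simp
    finally show "\<mu> (\<lambda>_. 1) x y \<le> 2" .
  qed
  show ?thesis using * by (auto simp: graph_square_def dest: wellformed')
qed

lemma has_cycle_3:
  assumes "pair_graph H"
  shows "has_cycle_of_length H 3 \<longleftrightarrow>
    (\<exists>a b c. (a, b) \<in> parcs H \<and> (b, c) \<in> parcs H \<and> (c, a) \<in> parcs H)" (is "_ \<longleftrightarrow> ?R")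
proof
  interpret pair_graph H by fact
  show ?R if "has_cycle_of_length H 3"
    using that
    by (fastforce simp: has_cycle_of_length_def cycle_def awalk_def numeral_eq_Suc length_Suc_conv)
  assume ?R
  then obtain a b c where *: "(a, b) \<in> parcs H" "(b, c) \<in> parcs H" "(c, a) \<in> parcs H" by blast
  then have "cycle [(a, b), (b, c), (c, a)]"
    using pair_graph_irreflD[OF assms] wellformed'
    by (auto simp: cycle_def awalk_def intro!: exI[of _ a])
  then show "has_cycle_of_length H 3" unfolding has_cycle_of_length_def by fastforce
qed

text \<open>
  A closed walk of length 5 in a triangle-free graph is a cycle: identifying two of its vertices
  would leave a closed walk of length 3.
\<close>

lemma has_cycle_5:
  assumes "pair_graph H" and "\<not> has_cycle_of_length H 3"
  shows "has_cycle_of_length H 5 \<longleftrightarrow>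
    (\<exists>a b c d e. (a, b) \<in> parcs H \<and> (b, c) \<in> parcs H \<and> (c, d) \<in> parcs H \<and>
       (d, e) \<in> parcs H \<and> (e, a) \<in> parcs H)" (is "_ \<longleftrightarrow> ?R")
proof
  interpret pair_graph H by fact
  show ?R if "has_cycle_of_length H 5"
    using that
    by (fastforce simp: has_cycle_of_length_def cycle_def awalk_def numeral_eq_Suc length_Suc_conv)
  assume ?R
  then obtain a b c d e where *: "(a, b) \<in> parcs H" "(b, c) \<in> parcs H" "(c, d) \<in> parcs H"
      "(d, e) \<in> parcs H" "(e, a) \<in> parcs H" by blast
  have no3: "(x, y) \<in> parcs H \<Longrightarrow> (y, z) \<in> parcs H \<Longrightarrow> (z, x) \<notin> parcs H" for x y z
    using assms has_cycle_3 by blast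
  have "b \<noteq> c" "c \<noteq> d" "d \<noteq> e" "e \<noteq> a" "a \<noteq> b"
    using * pair_graph_irreflD[OF assms(1)] by metis+
  moreover have "b \<noteq> d" "c \<noteq> e" "d \<noteq> a" "e \<noteq> b" "a \<noteq> c"
    using * no3 by metis+
  ultimately have "distinct [b, c, d, e, a]" by auto
  then have "cycle [(a, b), (b, c), (c, d), (d, e), (e, a)]"
    using * wellformed' by (auto simp: cycle_def awalk_def intro!: exI[of _ a])
  then show "has_cycle_of_length H 5" unfolding has_cycle_of_length_def by fastforce
qed

section \<open>Propagation of neighbourhoods and uniqueness\<close>

lemma root_neighbourhood:
  assumes H: "pair_graph H" "\<not> has_cycle_of_length H 3" "\<not> has_cycle_of_length H 5"
    and uv: "(v, u) \<in> parcs H"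
  shows "(u, x) \<in> parcs H \<longleftrightarrow> x = v \<or>
    (u, x) \<in> parcs (graph_square H) \<and> (v, x) \<in> parcs (graph_square H) \<and> (v, x) \<notin> parcs H"
proof -
  have no3: "(a, b) \<in> parcs H \<Longrightarrow> (b, c) \<in> parcs H \<Longrightarrow> (c, a) \<in> parcs H \<Longrightarrow> False" for a b c
    using H has_cycle_3 by blast
  have no5: "(a, b) \<in> parcs H \<Longrightarrow> (b, c) \<in> parcs H \<Longrightarrow> (c, d) \<in> parcs H \<Longrightarrow>
      (d, e) \<in> parcs H \<Longrightarrow> (e, a) \<in> parcs H \<Longrightarrow> False" for a b c d e
    using H has_cycle_5 by blast
  note sym = pair_graph_symD[OF H(1)] and irr = pair_graph_irreflD[OF H(1)]
  show ?thesis
  proof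
    \<comment> \<open>For \<open>x\<close> other than \<open>v\<close>, the path v-u-x puts
      \<open>(v, x)\<close> into the square, while an arc \<open>(v, x)\<close> would close a
      triangle.\<close>
    assume ux: "(u, x) \<in> parcs H"
    then show "x = v \<or> (u, x) \<in> parcs (graph_square H) \<and> (v, x) \<in> parcs (graph_square H) \<and>
        (v, x) \<notin> parcs H"
      using uv irr no3[OF uv ux] sym by (auto simp: graph_square_arcs[OF H(1)])
  next
    assume "x = v \<or> (u, x) \<in> parcs (graph_square H) \<and> (v, x) \<in> parcs (graph_square H) \<and>
        (v, x) \<notin> parcs H"
    then show "(u, x) \<in> parcs H"
      using uv sym no5 unfolding graph_square_arcs[OF H(1)] by metis
  qed
qed

lemma connected_closed_set:
  assumes G: "pair_graph G" "Digraph_Component.connected (with_proj G)"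
    and "v \<in> pverts G" "v \<in> S"
    and closed: "\<And>x y. x \<in> S \<Longrightarrow> (x, y) \<in> parcs G \<Longrightarrow> y \<in> S"
  shows "pverts G \<subseteq> S"
proof
  interpret pair_graph G by fact
  fix w assume "w \<in> pverts G"
  then have "(v, w) \<in> rtrancl_on (pverts G) ((parcs G)\<^sup>s)"
    using G(2) \<open>v \<in> pverts G\<close> by (simp add: connected_conv)
  then show "w \<in> S"
  proof (induct rule: rtrancl_on_induct)
    case base
    show ?case by fact
  next
    case (step x y)
    then have "(x, y) \<in> parcs G" by (auto simp: symcl_def intro: arcs_symmetric)
    with step show ?case using closed by blast
  qed
qed

text \<open>An arc of \<open>G\<close> is bridged by at most two arcs of \<open>H\<close>, so a set
  closed under \<open>H\<close> is closed under its square. Reachability in \<open>H\<close> thus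
  follows from the connectedness of \<open>G\<close>.\<close>

lemma root_closed_set:
  assumes "Digraph_Component.connected (with_proj G)" "pair_graph G" "v \<in> pverts G" "v \<in> S"
    and "C3_C5_free_root_at G v U H"
    and closed: "\<And>x y. x \<in> S \<Longrightarrow> (x, y) \<in> parcs H \<Longrightarrow> y \<in> S"
  shows "pverts G \<subseteq> S"
proof (rule connected_closed_set[OF assms(2,1,3,4)])
  have "pair_graph H" "graph_square H = G"
    using assms(5) by (auto simp: C3_C5_free_root_at_def)
  then show "y \<in> S" if "x \<in> S" "(x, y) \<in> parcs G" for x y
    using that closed graph_square_arcs[of H] by blast
qed

lemma root_unique:
  assumes G: "pair_graph G" "Digraph_Component.connected (with_proj G)" "v \<in> pverts G"
    and H: "C3_C5_free_root_at G v U H" and H': "C3_C5_free_root_at G v U H'"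
  shows "H = H'"
proof -
  have h: "pair_graph H" "\<not> has_cycle_of_length H 3" "\<not> has_cycle_of_length H 5"
      "graph_square H = G" "neighbourhood H v = U"
    and h': "pair_graph H'" "\<not> has_cycle_of_length H' 3" "\<not> has_cycle_of_length H' 5"
      "graph_square H' = G" "neighbourhood H' v = U"
    using H H' by (auto simp: C3_C5_free_root_at_def)
  let ?S = "{u. \<forall>x. (u, x) \<in> parcs H \<longleftrightarrow> (u, x) \<in> parcs H'}"
  have "pverts G \<subseteq> ?S"
  proof (rule root_closed_set[OF G(2,1,3) _ H])
    show "v \<in> ?S" using h(5) h'(5) by (auto simp: neighbourhood_def)
  next
    fix x y assume x: "x \<in> ?S" and xy: "(x, y) \<in> parcs H"
    then have xy': "(x, y) \<in> parcs H'" by blast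
    \<comment> \<open>The right-hand side of \<open>root_neighbourhood\<close> depends on the root
      only through its square, which is \<open>G\<close> for both, and through the row of
      \<open>x\<close>, on which both agree.\<close>
    show "y \<in> ?S"
      using x root_neighbourhood[OF h(1,2,3) xy] root_neighbourhood[OF h'(1,2,3) xy']
      by (simp add: h(4) h'(4))
  qed
  moreover have V: "pverts H = pverts G" "pverts H' = pverts G"
    using h(4) h'(4) graph_square_verts by metis+
  ultimately have "parcs H = parcs H'"
    using pair_graph_wfD[OF h(1)] pair_graph_wfD[OF h'(1)] by (intro equalityI subrelI; blast)
  with V show ?thesis by simp
qed

section \<open>Programs\<close>

lemma fits_mono: "fits W s e \<Longrightarrow> W \<le> W' \<Longrightarrow> fits W' s e"
  by (induction e) auto

text \<open>Lets a multiplication program that comes with its own exponent run under the larger word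
  bound of the surrounding code.\<close>

lemma exec_mono: "exec W p s t s' \<Longrightarrow> W \<le> W' \<Longrightarrow> exec W' p s t s'"
  by (induction rule: exec.induct) (blast intro: exec.intros fits_mono)+

text \<open>A write changes at most one cell and costs at least one step, and changes add up along
  sequences and loop passes. This turns the size of an output into a lower bound on time.\<close>

lemma exec_card_changed:
  assumes "exec W p s t s'"
  shows "finite {(X, a). s X a \<noteq> s' X a} \<and> card {(X, a). s X a \<noteq> s' X a} \<le> t"
proof -
  have trans: "finite {(X, a). s X a \<noteq> s'' X a} \<and> card {(X, a). s X a \<noteq> s'' X a} \<le> c + t + t'"
    if "finite {(X, a). s X a \<noteq> s' X a} \<and> card {(X, a). s X a \<noteq> s' X a} \<le> t"
      "finite {(X, a). s' X a \<noteq> s'' X a} \<and> card {(X, a). s' X a \<noteq> s'' X a} \<le> t'"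
    for s s' s'' :: memory and c t t'
  proof -
    have sub: "{(X, a). s X a \<noteq> s'' X a} \<subseteq> {(X, a). s X a \<noteq> s' X a} \<union> {(X, a). s' X a \<noteq> s'' X a}"
      by auto
    then have "card {(X, a). s X a \<noteq> s'' X a} \<le>
        card ({(X, a). s X a \<noteq> s' X a} \<union> {(X, a). s' X a \<noteq> s'' X a})"
      using that by (intro card_mono) auto
    also have "\<dots> \<le> t + t'"
      using that card_Un_le add_mono order_trans by blast
    finally show ?thesis using sub that by (auto intro: finite_subset)
  qed
  show ?thesis
    using assms
  proof induction
    case (Write s a e X)
    have "{(Y, b). s Y b \<noteq> (s(X := (s X)(eval_expr s a := eval_expr s e))) Y b}
        \<subseteq> {(X, eval_expr s a)}" by (auto split: if_splits)
    then have "finite {(Y, b). s Y b \<noteq> (s(X := (s X)(eval_expr s a := eval_expr s e))) Y b}"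
      "card {(Y, b). s Y b \<noteq> (s(X := (s X)(eval_expr s a := eval_expr s e))) Y b} \<le> 1"
      by (auto dest: finite_subset card_mono[rotated])
    then show ?case by simp
  next
    case (Seq p s t s' q t' s'')
    show ?case using trans[OF Seq.IH] .
  next
    case (WhileTrue s a b p t s' t' s'')
    show ?case using trans[OF WhileTrue.IH] .
  qed auto
qed

section \<open>Renaming of memory banks\<close>

text \<open>Running the same program on disjoint banks makes it a subroutine with fresh memory.\<close>

primrec rename_expr :: "(nat \<Rightarrow> nat) \<Rightarrow> expr \<Rightarrow> expr" where
  "rename_expr f (Const c) = Const c"
| "rename_expr f (Read X a) = Read (f X) (rename_expr f a)"
| "rename_expr f (Add a b) = Add (rename_expr f a) (rename_expr f b)"
| "rename_expr f (Sub a b) = Sub (rename_expr f a) (rename_expr f b)"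
| "rename_expr f (Mul a b) = Mul (rename_expr f a) (rename_expr f b)"
| "rename_expr f (Div a b) = Div (rename_expr f a) (rename_expr f b)"

primrec rename_prog :: "(nat \<Rightarrow> nat) \<Rightarrow> prog \<Rightarrow> prog" where
  "rename_prog f Skip = Skip"
| "rename_prog f (Write X a e) = Write (f X) (rename_expr f a) (rename_expr f e)"
| "rename_prog f (Seq p q) = Seq (rename_prog f p) (rename_prog f q)"
| "rename_prog f (IfLess a b p q) =
     IfLess (rename_expr f a) (rename_expr f b) (rename_prog f p) (rename_prog f q)"
| "rename_prog f (WhileLess a b p) =
     WhileLess (rename_expr f a) (rename_expr f b) (rename_prog f p)"

lemma eval_rename_expr [simp]: "eval_expr m (rename_expr f e) = eval_expr (\<lambda>X. m (f X)) e"
  by (induction e) auto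

lemma fits_rename_expr [simp]: "fits W m (rename_expr f e) \<longleftrightarrow> fits W (\<lambda>X. m (f X)) e"
  by (induction e) auto

lemma time_rename_expr [simp]: "expr_time (rename_expr f e) = expr_time e"
  by (induction e) auto

text \<open>Injectivity of \<open>f\<close> makes the renamed memory a faithful copy: a write to
  bank \<open>f X\<close> is seen in bank \<open>X\<close> only. The last conjunct is the frame
  condition that protects the banks of the caller.\<close>

lemma exec_rename_prog:
  assumes "exec W p s t s'" and "inj f" and "(\<lambda>X. m (f X)) = s"
  shows "\<exists>m'. exec W (rename_prog f p) m t m' \<and> (\<lambda>X. m' (f X)) = s' \<and> (\<forall>Y. Y \<notin> range f \<longrightarrow> m' Y = m Y)"
  using assms(1,3)
proof (induction arbitrary: m)
  case (Skip s)
  have "exec W (rename_prog f Skip) m 1 m" by (simp only: rename_prog.simps exec.Skip)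
  with Skip show ?case by blast
next
  case (Write s a e X)
  let ?m = "m(f X := (m (f X))(eval_expr s a := eval_expr s e))"
  have "exec W (rename_prog f (Write X a e)) m (1 + expr_time a + expr_time e) ?m"
    using exec.Write[of W m "rename_expr f a" "rename_expr f e" "f X"] Write by simp
  moreover have "(\<lambda>Y. ?m (f Y)) = s(X := (s X)(eval_expr s a := eval_expr s e))"
    using Write.prems injD[OF \<open>inj f\<close>] by (auto simp: fun_eq_iff)
  moreover have "\<forall>Y. Y \<notin> range f \<longrightarrow> ?m Y = m Y" by auto
  ultimately show ?case unfolding rename_prog.simps by blast
next
  case (Seq p s t s' q t' s'')
  then obtain m' where m': "exec W (rename_prog f p) m t m'" "(\<lambda>X. m' (f X)) = s'"
    "\<forall>Y. Y \<notin> range f \<longrightarrow> m' Y = m Y" by blast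
  with Seq obtain m'' where "exec W (rename_prog f q) m' t' m''" "(\<lambda>X. m'' (f X)) = s''"
    "\<forall>Y. Y \<notin> range f \<longrightarrow> m'' Y = m' Y" by blast
  with m' show ?case by (intro exI[of _ m'']) (simp del: One_nat_def add: exec.Seq)
next
  case (IfTrue s a b p t s' q)
  then obtain m' where "exec W (rename_prog f p) m t m'" "(\<lambda>X. m' (f X)) = s'"
    "\<forall>Y. Y \<notin> range f \<longrightarrow> m' Y = m Y" by blast
  with IfTrue show ?case
    using exec.IfTrue[of W m "rename_expr f a" "rename_expr f b" "rename_prog f p" t m' "rename_prog f q"]
    by (intro exI[of _ m']) (simp del: One_nat_def)
next
  case (IfFalse s a b q t s' p)
  then obtain m' where "exec W (rename_prog f q) m t m'" "(\<lambda>X. m' (f X)) = s'"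
    "\<forall>Y. Y \<notin> range f \<longrightarrow> m' Y = m Y" by blast
  with IfFalse show ?case
    using exec.IfFalse[of W m "rename_expr f a" "rename_expr f b" "rename_prog f q" t m' "rename_prog f p"]
    by (intro exI[of _ m']) (simp del: One_nat_def)
next
  case (WhileFalse s a b p)
  then show ?case
    using exec.WhileFalse[of W m "rename_expr f a" "rename_expr f b"]
    by (intro exI[of _ m]) (simp del: One_nat_def)
next
  case (WhileTrue s a b p t s' t' s'')
  then obtain m' where m': "exec W (rename_prog f p) m t m'" "(\<lambda>X. m' (f X)) = s'"
    "\<forall>Y. Y \<notin> range f \<longrightarrow> m' Y = m Y" by blast
  with WhileTrue obtain m'' where "exec W (rename_prog f (WhileLess a b p)) m' t' m''"
    "(\<lambda>X. m'' (f X)) = s''" "\<forall>Y. Y \<notin> range f \<longrightarrow> m'' Y = m' Y" by blast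
  with m' WhileTrue show ?case
    using exec.WhileTrue[of W m "rename_expr f a" "rename_expr f b" "rename_prog f p" t m' t' m'']
    by (intro exI[of _ m'']) (simp del: One_nat_def)
qed

section \<open>Total correctness with time bounds\<close>

text \<open>Time is only bounded from above, so branches and loop passes of different cost can share
  one bound.\<close>

definition runs :: "int \<Rightarrow> prog \<Rightarrow> memory \<Rightarrow> nat \<Rightarrow> (memory \<Rightarrow> bool) \<Rightarrow> bool" where
  "runs W p s t Q \<longleftrightarrow> (\<exists>t' s'. exec W p s t' s' \<and> t' \<le> t \<and> Q s')"

lemma runs_conseq: "runs W p s t Q \<Longrightarrow> t \<le> t' \<Longrightarrow> (\<And>s'. Q s' \<Longrightarrow> Q' s') \<Longrightarrow> runs W p s t' Q'"
  unfolding runs_def using order_trans by blast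

lemma runs_Seq:
  assumes "runs W p s t\<^sub>1 R" and "\<And>s'. R s' \<Longrightarrow> runs W q s' t\<^sub>2 Q"
  shows "runs W (Seq p q) s (1 + t\<^sub>1 + t\<^sub>2) Q"
proof -
  from assms(1) obtain t' s' where 1: "exec W p s t' s'" "t' \<le> t\<^sub>1" "R s'"
    by (auto simp: runs_def)
  from assms(2)[OF 1(3)] obtain t'' s'' where 2: "exec W q s' t'' s''" "t'' \<le> t\<^sub>2" "Q s''"
    by (auto simp: runs_def)
  from exec.Seq[OF 1(1) 2(1)] 1 2 show ?thesis by (fastforce simp: runs_def)
qed

lemma runs_IfLess:
  assumes "fits W s a" "fits W s b"
    and "eval_expr s a < eval_expr s b \<Longrightarrow> runs W p s t Q"
    and "\<not> eval_expr s a < eval_expr s b \<Longrightarrow> runs W q s t Q"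
  shows "runs W (IfLess a b p q) s (1 + expr_time a + expr_time b + t) Q"
  using assms unfolding runs_def
  by (cases "eval_expr s a < eval_expr s b") (fastforce intro: exec.intros)+

text \<open>Only meaningful for loop-free programs: a loop gets the precondition False and the time 0.\<close>

primrec wp :: "int \<Rightarrow> prog \<Rightarrow> (memory \<Rightarrow> bool) \<Rightarrow> memory \<Rightarrow> bool" where
  "wp W Skip Q s = Q s"
| "wp W (Write X a e) Q s =
    (fits W s a \<and> fits W s e \<and> Q (s(X := (s X)(eval_expr s a := eval_expr s e))))"
| "wp W (Seq p q) Q s = wp W p (wp W q Q) s"
| "wp W (IfLess a b p q) Q s =
    (fits W s a \<and> fits W s b \<and> (if eval_expr s a < eval_expr s b then wp W p Q s else wp W q Q s))"
| "wp W (WhileLess a b p) Q s = False"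

text \<open>Depends on the program text alone. A conditional is charged with both branches, which
  avoids maxima in the later arithmetic.\<close>

primrec cost :: "prog \<Rightarrow> nat" where
  "cost Skip = 1"
| "cost (Write X a e) = 1 + expr_time a + expr_time e"
| "cost (Seq p q) = 1 + cost p + cost q"
| "cost (IfLess a b p q) = 1 + expr_time a + expr_time b + (cost p + cost q)"
| "cost (WhileLess a b p) = 0"

lemma runs_wp: "wp W p Q s \<Longrightarrow> runs W p s (cost p) Q"
proof (induction p arbitrary: Q s)
  case Skip
  then have "exec W Skip s 1 s \<and> 1 \<le> cost Skip \<and> Q s" by (simp add: exec.Skip[unfolded One_nat_def])
  then show ?case unfolding runs_def by blast
next
  case (Write X a e)
  then show ?case by (fastforce simp: runs_def intro: exec.intros)
next
  case (Seq p q)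
  then show ?case unfolding cost.simps wp.simps by (intro runs_Seq[where R = "wp W q Q"]) auto
next
  case (IfLess a b p q)
  then show ?case
    unfolding cost.simps wp.simps
    by (intro runs_IfLess) (auto split: if_splits intro!: runs_conseq[OF IfLess.IH(1)] runs_conseq[OF IfLess.IH(2)])
qed simp

abbreviation var :: "nat \<Rightarrow> expr" where
  "var X \<equiv> Read X (Const 0)"

definition for_loop :: "nat \<Rightarrow> expr \<Rightarrow> prog \<Rightarrow> prog" where
  "for_loop i e p = Seq (Write i (Const 0) (Const 0))
     (WhileLess (var i) e (Seq p (Write i (Const 0) (Add (var i) (Const 1)))))"

text \<open>Besides the body, a pass pays \<open>expr_time e + 10\<close> for the test, the
  sequencing and the increment. The additional pass in the factor \<open>m + 1\<close> covers the
  initialisation and the final, failing test. The invariant refers to the memory in which the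
  counter is already updated.\<close>

lemma runs_for_loop:
  fixes I :: "int \<Rightarrow> memory \<Rightarrow> bool"
  assumes init: "I 0 (s(i := (s i)(0 := 0)))"
    and bound: "\<And>k s. I k s \<Longrightarrow> 0 \<le> k \<Longrightarrow> k \<le> int m \<Longrightarrow> s i 0 = k \<Longrightarrow> fits W s e \<and> eval_expr s e = int m"
    and body: "\<And>k s. I k s \<Longrightarrow> 0 \<le> k \<Longrightarrow> k < int m \<Longrightarrow> s i 0 = k \<Longrightarrow>
      runs W p s t (\<lambda>s'. s' i 0 = k \<and> I (k + 1) (s'(i := (s' i)(0 := k + 1))))"
    and exit: "\<And>s. I (int m) s \<Longrightarrow> Q s"
    and W: "int m + 1 \<le> W"
  shows "runs W (for_loop i e p) s ((m + 1) * (t + expr_time e + 10)) Q"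
proof -
  let ?q = "Seq p (Write i (Const 0) (Add (var i) (Const 1)))"
  have while: "runs W (WhileLess (var i) e ?q) s ((m - k) * (t + expr_time e + 10) + (3 + expr_time e)) Q"
    if "I (int k) s" "s i 0 = int k" "k \<le> m" for k s
    using that
  proof (induction "m - k" arbitrary: k s)
    case 0
    with bound[OF 0(2)] have "exec W (WhileLess (var i) e ?q) s (1 + expr_time (var i) + expr_time e) s"
      using W by (intro exec.WhileFalse) auto
    moreover have "Q s" using exit 0 by simp
    ultimately show ?case using 0 by (fastforce simp: runs_def)
  next
    case (Suc d)
    then have k: "k < m" by linarith
    from body[OF Suc(3)] Suc k obtain t\<^sub>1 s\<^sub>1 where 1: "exec W p s t\<^sub>1 s\<^sub>1" "t\<^sub>1 \<le> t" "s\<^sub>1 i 0 = int k"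
        "I (int k + 1) (s\<^sub>1(i := (s\<^sub>1 i)(0 := int k + 1)))" by (auto simp: runs_def)
    let ?s = "s\<^sub>1(i := (s\<^sub>1 i)(0 := int k + 1))"
    have "exec W ?q s (1 + t\<^sub>1 + 6) ?s"
      using exec.Seq[OF 1(1) exec.Write[of W s\<^sub>1 "Const 0" "Add (var i) (Const 1)" i]] 1 W k
      by (simp add: numeral_eq_Suc)
    moreover have "runs W (WhileLess (var i) e ?q) ?s
        ((m - Suc k) * (t + expr_time e + 10) + (3 + expr_time e)) Q"
      using Suc(1)[of "Suc k" ?s] Suc(2,4,5) 1 k by (simp add: add.commute)
    then obtain t\<^sub>2 s\<^sub>2 where 2: "exec W (WhileLess (var i) e ?q) ?s t\<^sub>2 s\<^sub>2"
      "t\<^sub>2 \<le> (m - Suc k) * (t + expr_time e + 10) + (3 + expr_time e)" "Q s\<^sub>2" by (auto simp: runs_def)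
    ultimately have "exec W (WhileLess (var i) e ?q) s
        (1 + expr_time (var i) + expr_time e + (1 + t\<^sub>1 + 6) + t\<^sub>2) s\<^sub>2"
      using bound[OF Suc(3)] Suc(4) k W by (intro exec.WhileTrue) auto
    moreover have "m - k = Suc (m - Suc k)" using k by simp
    then have "1 + expr_time (var i) + expr_time e + (1 + t\<^sub>1 + 6) + t\<^sub>2 \<le>
        (m - k) * (t + expr_time e + 10) + (3 + expr_time e)"
      using 1(2) 2(2) by simp
    ultimately show ?case using 2(3) unfolding runs_def by blast
  qed
  have "runs W (for_loop i e p) s (1 + 3 + ((m - 0) * (t + expr_time e + 10) + (3 + expr_time e))) Q"
    unfolding for_loop_def
  proof (rule runs_Seq)
    have "exec W (Write i (Const 0) (Const 0)) s 3 (s(i := (s i)(0 := 0)))"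
      using exec.Write[of W s "Const 0" "Const 0" i] W by (simp add: numeral_eq_Suc)
    then show "runs W (Write i (Const 0) (Const 0)) s 3 (\<lambda>s'. s' = s(i := (s i)(0 := 0)))"
      by (auto simp: runs_def)
  next
    fix s' assume "s' = s(i := (s i)(0 := 0))"
    then show "runs W (WhileLess (var i) e ?q) s' ((m - 0) * (t + expr_time e + 10) + (3 + expr_time e)) Q"
      using while[of 0 s'] init by simp
  qed
  then show ?thesis by (rule runs_conseq) (auto simp: algebra_simps)
qed

section \<open>Searching for the candidate\<close>

text \<open>
  Banks of the search: 3 the candidate, 5 visited flags, 6 the queue, 7 the search tree (parents),
  8 and 9 loop counters, 10 the length of the queue, 11 the current vertex and 12 its parent. Bank 4 is
  left to the verdict, and the subroutines live in banks from 13 upwards, hence still zero afterwards.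
\<close>

abbreviation addr :: "expr \<Rightarrow> expr \<Rightarrow> expr" where
  "addr i j \<equiv> Add (Mul i (var 0)) j"

definition row_body :: prog where
  "row_body = Write 3 (addr (var 11) (var 9))
     (Mul (Mul (Read 1 (addr (var 11) (var 9))) (Read 1 (addr (var 12) (var 9))))
       (Sub (Const 1) (Read 3 (addr (var 12) (var 9)))))"

text \<open>The product in \<open>row_body\<close> is the conjunction of
  \<open>root_neighbourhood\<close> on 0-1 values, with the parent in the role of \<open>v\<close>.
  The separate write supplies the other alternative, the entry for the parent itself.\<close>

definition expand_row :: prog where
  "expand_row = Seq (for_loop 9 (var 0) row_body) (Write 3 (addr (var 11) (var 12)) (Const 1))"

text \<open>Both cells compared are 0 or 1, so the first is less than the second exactly for a
  neighbour not yet visited.\<close>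

definition discover_body :: prog where
  "discover_body = IfLess (Read 5 (var 9)) (Read 3 (addr (var 11) (var 9)))
     (Seq (Write 5 (var 9) (Const 1)) (Seq (Write 6 (var 10) (var 9))
       (Seq (Write 7 (var 9) (var 11)) (Write 10 (Const 0) (Add (var 10) (Const 1))))))
     Skip"

text \<open>The test on the counter exempts the first queue entry \<open>v\<close>: its row comes
  from \<open>U\<close>, not from a parent.\<close>

definition search_body :: prog where
  "search_body = Seq (Seq (Write 11 (Const 0) (Read 6 (var 8))) (Write 12 (Const 0) (Read 7 (var 11))))
     (Seq (IfLess (Const 0) (var 8) expand_row Skip) (for_loop 9 (var 0) discover_body))"

definition start_body :: prog where
  "start_body = Write 3 (addr (Read 0 (Const 1)) (var 9)) (Read 2 (var 9))"

text \<open>The number of rounds is fixed. If a root exists, the queue lasts for all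
  \<open>n\<close> rounds; otherwise it may run dry, and the remaining rounds work on whatever bank
  6 contains.\<close>

definition search :: prog where
  "search = Seq (Seq (Seq (Write 5 (Read 0 (Const 1)) (Const 1)) (Seq (Write 6 (Const 0) (Read 0 (Const 1)))
       (Write 10 (Const 0) (Const 1)))) (for_loop 9 (var 0) start_body))
     (for_loop 8 (var 0) search_body)"

definition expand_time :: "nat \<Rightarrow> nat" where
  "expand_time n = 1 + (n + 1) * (cost row_body + 12) + cost (Write 3 (addr (var 11) (var 12)) (Const 1))"

definition search_body_time :: "nat \<Rightarrow> nat" where
  "search_body_time n = 1 + cost (Seq (Write 11 (Const 0) (Read 6 (var 8))) (Write 12 (Const 0) (Read 7 (var 11)))) +
    (1 + (4 + expand_time n) + (n + 1) * (cost discover_body + 12))"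

definition search_time :: "nat \<Rightarrow> nat" where
  "search_time n = 1 + (1 + 13 + (n + 1) * (cost start_body + 12)) + (n + 1) * (search_body_time n + 12)"

section \<open>Invariants of the search\<close>

text \<open>The bound on \<open>W\<close> dominates the penalty of the verification, which is at
  most \<open>4 * N * N + N + 3\<close>, as well as addresses, loop counters and the length of the
  queue. The locale does not presuppose a root.\<close>

locale search_instance =
  fixes n :: nat and v W :: int and g U :: "int \<Rightarrow> int"
  assumes v: "0 \<le> v" "v < int n"
    and g01: "\<And>a. g a = 0 \<or> g a = 1"
    and U01: "\<And>a. U a = 0 \<or> U a = 1"
    and W: "5 * (int n * int n) + 10 * int n + 50 \<le> W"
begin

abbreviation N :: int where "N \<equiv> int n"

lemma addr_bounds:
  assumes "0 \<le> u" "u < N" "0 \<le> x" "x < N"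
  shows "0 \<le> u * N" "u * N \<le> N * N" "0 \<le> u * N + x" "u * N + x < N * N"
proof -
  have "(u + 1) * N \<le> N * N" using assms by (intro mult_right_mono) auto
  then show "u * N \<le> N * N" "u * N + x < N * N" using assms by (auto simp: algebra_simps)
qed (use assms in auto)

lemma addr_eq_iff:
  assumes "0 \<le> x" "x < N" "0 \<le> y" "y < N"
  shows "u * N + x = w * N + y \<longleftrightarrow> u = w \<and> x = y"
proof
  assume eq: "u * N + x = w * N + y"
  have "u = (u * N + x) div N" "w = (w * N + y) div N" using assms by auto
  then have "u = w" using eq by simp
  with eq show "u = w \<and> x = y" by simp
qed simp

lemma W_bounds: "0 \<le> W" "1 \<le> W" "N \<le> W" "N + 1 \<le> W" "v \<le> W" "N * N \<le> W" "N * N + 1 \<le> W"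
proof -
  have "0 \<le> N * N" by simp
  with W v show "0 \<le> W" "1 \<le> W" "N \<le> W" "N + 1 \<le> W" "v \<le> W" "N * N \<le> W" "N * N + 1 \<le> W"
    by linarith+
qed

text \<open>The half of the invariant that holds on every input. It ranges over all cells, so that
  even an entry read beyond the end of the queue is a vertex number and leads to addresses within
  the word bound.\<close>

definition safe :: "memory \<Rightarrow> bool" where
  "safe s \<longleftrightarrow> s 0 0 = N \<and> s 0 1 = v \<and> s 1 = g \<and> s 2 = U \<and> (\<forall>a. s 3 a = 0 \<or> s 3 a = 1) \<and>
     (\<forall>a. s 5 a = 0 \<or> s 5 a = 1) \<and> (\<forall>a. 0 \<le> s 6 a \<and> s 6 a < N) \<and>
     (\<forall>a. 0 \<le> s 7 a \<and> s 7 a < N) \<and> (\<forall>X \<ge> 13. s X = (\<lambda>_. 0))"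

text \<open>What the search uses about a root; the last clause is its connectedness.\<close>

definition candidate :: "(int \<Rightarrow> int \<Rightarrow> bool) \<Rightarrow> bool" where
  "candidate R \<longleftrightarrow>
     (\<forall>x y. R x y \<longrightarrow> 0 \<le> x \<and> x < N \<and> 0 \<le> y \<and> y < N \<and> x \<noteq> y) \<and>
     (\<forall>x. 0 \<le> x \<longrightarrow> x < N \<longrightarrow> U x = of_bool (R v x)) \<and>
     (\<forall>p u x. R p u \<longrightarrow> 0 \<le> x \<longrightarrow> x < N \<longrightarrow>
        (R u x \<longleftrightarrow> x = p \<or> g (u * N + x) = 1 \<and> g (p * N + x) = 1 \<and> \<not> R p x)) \<and>
     (\<forall>S. v \<in> S \<longrightarrow> (\<forall>x\<in>S. \<forall>y. R x y \<longrightarrow> y \<in> S) \<longrightarrow> {0..<N} \<subseteq> S)"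

lemma candidate_range:
  "candidate R \<Longrightarrow> R x y \<Longrightarrow> 0 \<le> x \<and> x < N \<and> 0 \<le> y \<and> y < N \<and> x \<noteq> y"
  unfolding candidate_def by blast

lemma candidate_start: "candidate R \<Longrightarrow> 0 \<le> x \<Longrightarrow> x < N \<Longrightarrow> U x = of_bool (R v x)"
  unfolding candidate_def by blast

lemma candidate_reach:
  assumes "candidate R" "v \<in> S" "\<And>x y. x \<in> S \<Longrightarrow> R x y \<Longrightarrow> y \<in> S"
  shows "{0..<N} \<subseteq> S"
proof -
  have "v \<in> S \<longrightarrow> (\<forall>x\<in>S. \<forall>y. R x y \<longrightarrow> y \<in> S) \<longrightarrow> {0..<N} \<subseteq> S"
    using assms(1) unfolding candidate_def by (elim conjE) (erule spec)
  with assms(2,3) show ?thesis by blast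
qed

definition row_ok :: "(int \<Rightarrow> int \<Rightarrow> bool) \<Rightarrow> memory \<Rightarrow> int \<Rightarrow> bool" where
  "row_ok R s u \<longleftrightarrow> (\<forall>x. 0 \<le> x \<longrightarrow> x < N \<longrightarrow> s 3 (u * N + x) = of_bool (R u x))"

text \<open>
  Invariant of the search: the first \<open>h\<close> entries of the queue are processed, and the neighbours below \<open>x\<close>
  of entry \<open>h\<close> have been discovered.
\<close>

definition found :: "(int \<Rightarrow> int \<Rightarrow> bool) \<Rightarrow> int \<Rightarrow> int \<Rightarrow> memory \<Rightarrow> bool" where
  "found R h x s \<longleftrightarrow>
     1 \<le> s 10 0 \<and> h \<le> s 10 0 \<and> s 6 0 = v \<and> inj_on (s 6) {0..<s 10 0} \<and>
     (\<forall>y. 0 \<le> y \<longrightarrow> y < N \<longrightarrow> (s 5 y = 1 \<longleftrightarrow> y \<in> s 6 ` {0..<s 10 0})) \<and>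
     row_ok R s v \<and> (\<forall>i. 0 \<le> i \<longrightarrow> i < h \<longrightarrow> row_ok R s (s 6 i)) \<and>
     (\<forall>i y. 0 \<le> i \<longrightarrow> i < h \<longrightarrow> R (s 6 i) y \<longrightarrow> s 5 y = 1) \<and>
     (\<forall>y. 0 \<le> y \<longrightarrow> y < x \<longrightarrow> R (s 6 h) y \<longrightarrow> s 5 y = 1) \<and>
     (\<forall>i. 0 < i \<longrightarrow> i < s 10 0 \<longrightarrow> R (s 7 (s 6 i)) (s 6 i) \<and> row_ok R s (s 7 (s 6 i)))"

lemma foundD:
  assumes "found R h x s"
  shows found_tail: "1 \<le> s 10 0" "h \<le> s 10 0"
    and found_first: "s 6 0 = v"
    and found_inj: "inj_on (s 6) {0..<s 10 0}"
    and found_visited: "0 \<le> y \<Longrightarrow> y < N \<Longrightarrow> s 5 y = 1 \<longleftrightarrow> y \<in> s 6 ` {0..<s 10 0}"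
    and found_row_start: "row_ok R s v"
    and found_row: "0 \<le> i \<Longrightarrow> i < h \<Longrightarrow> row_ok R s (s 6 i)"
    and found_closed: "0 \<le> i \<Longrightarrow> i < h \<Longrightarrow> R (s 6 i) y \<Longrightarrow> s 5 y = 1"
    and found_partial: "0 \<le> y \<Longrightarrow> y < x \<Longrightarrow> R (s 6 h) y \<Longrightarrow> s 5 y = 1"
    and found_parent: "0 < i \<Longrightarrow> i < s 10 0 \<Longrightarrow> R (s 7 (s 6 i)) (s 6 i)"
      "0 < i \<Longrightarrow> i < s 10 0 \<Longrightarrow> row_ok R s (s 7 (s 6 i))"
  using assms unfolding found_def by blast+

lemma foundI:
  assumes "1 \<le> s 10 0" "h \<le> s 10 0" "s 6 0 = v" "inj_on (s 6) {0..<s 10 0}"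
    and "\<And>y. 0 \<le> y \<Longrightarrow> y < N \<Longrightarrow> s 5 y = 1 \<longleftrightarrow> y \<in> s 6 ` {0..<s 10 0}"
    and "row_ok R s v" "\<And>i. 0 \<le> i \<Longrightarrow> i < h \<Longrightarrow> row_ok R s (s 6 i)"
    and "\<And>i y. 0 \<le> i \<Longrightarrow> i < h \<Longrightarrow> R (s 6 i) y \<Longrightarrow> s 5 y = 1"
    and "\<And>y. 0 \<le> y \<Longrightarrow> y < x \<Longrightarrow> R (s 6 h) y \<Longrightarrow> s 5 y = 1"
    and "\<And>i. 0 < i \<Longrightarrow> i < s 10 0 \<Longrightarrow> R (s 7 (s 6 i)) (s 6 i)"
    and "\<And>i. 0 < i \<Longrightarrow> i < s 10 0 \<Longrightarrow> row_ok R s (s 7 (s 6 i))"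
  shows "found R h x s"
  unfolding found_def using assms by blast

lemma safe_upd [simp]: "8 \<le> Y \<Longrightarrow> Y < 13 \<Longrightarrow> safe (s(Y := m)) \<longleftrightarrow> safe s"
  by (auto simp: safe_def)

lemma row_ok_upd [simp]: "Y \<noteq> 3 \<Longrightarrow> row_ok R (s(Y := m)) u \<longleftrightarrow> row_ok R s u"
  by (simp add: row_ok_def)

lemma found_upd [simp]: "Y \<notin> {3, 5, 6, 7, 10} \<Longrightarrow> found R h x (s(Y := m)) \<longleftrightarrow> found R h x s"
  by (simp add: found_def)

text \<open>If the queue were exhausted, the visited vertices would be a closed set of fewer than \<open>n\<close> vertices.\<close>

lemma found_nonempty:
  assumes "candidate R" "found R h 0 s" "0 \<le> h" "h < N"
  shows "h < s 10 0"
proof (rule ccontr)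
  assume "\<not> h < s 10 0"
  then have h: "h = s 10 0" using found_tail[OF assms(2)] by simp
  let ?S = "s 6 ` {0..<h}"
  have "s 6 0 = v" "0 < h" using foundD(1,3)[OF assms(2)] h by auto
  then have "v \<in> ?S" by force
  moreover have "y \<in> ?S" if "x \<in> ?S" "R x y" for x y
  proof -
    have "0 \<le> y" "y < N" using candidate_range[OF assms(1) that(2)] by auto
    moreover have "s 5 y = 1" using found_closed[OF assms(2)] that by force
    ultimately show ?thesis using found_visited[OF assms(2)] h by simp
  qed
  ultimately have "{0..<N} \<subseteq> ?S" using candidate_reach[OF assms(1)] by blast
  then have "card {0..<N} \<le> card ?S" by (intro card_mono) auto
  also have "\<dots> \<le> card {0..<h}" by (intro card_image_le) auto
  finally show False using assms(3,4) by simp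
qed

text \<open>The first \<open>N\<close> queue entries are pairwise distinct numbers below
  \<open>N\<close>, so they exhaust the vertices, and each of them has been processed.\<close>

lemma found_complete:
  assumes "safe s" "found R N 0 s" "0 \<le> u" "u < N"
  shows "row_ok R s u"
proof -
  have "N \<le> s 10 0" "inj_on (s 6) {0..<s 10 0}" using foundD(2,4)[OF assms(2)] by blast+
  then have "inj_on (s 6) {0..<N}" by (auto elim: inj_on_subset)
  then have "card (s 6 ` {0..<N}) = card {0..<N}" by (rule card_image)
  moreover have "s 6 ` {0..<N} \<subseteq> {0..<N}" using assms(1) by (auto simp: safe_def)
  ultimately have "s 6 ` {0..<N} = {0..<N}" by (intro card_subset_eq) auto
  with assms(3,4) obtain i where "0 \<le> i" "i < N" "u = s 6 i"
    by (metis atLeastLessThan_iff imageE)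
  then show ?thesis using found_row[OF assms(2)] by simp
qed

section \<open>Correctness of the search\<close>

definition new_row :: "memory \<Rightarrow> int \<Rightarrow> int \<Rightarrow> int \<Rightarrow> int" where
  "new_row s p u x = g (u * N + x) * g (p * N + x) * (1 - s 3 (p * N + x))"

text \<open>The loop reads row \<open>p\<close> while it writes row \<open>u\<close>. Without a root
  the two may coincide, and then only the 0-1 values are guaranteed; hence the guard
  \<open>u \<noteq> p\<close>.\<close>

lemma runs_row_loop:
  assumes s: "safe s" "s 11 0 = u" "s 12 0 = p" and u: "0 \<le> u" "u < N" and p: "0 \<le> p" "p < N"
  shows "runs W (for_loop 9 (var 0) row_body) s ((n + 1) * (cost row_body + 12))
    (\<lambda>s'. (\<forall>Y. Y \<noteq> 3 \<longrightarrow> Y \<noteq> 9 \<longrightarrow> s' Y = s Y) \<and> (\<forall>a. s' 3 a = 0 \<or> s' 3 a = 1) \<and>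
       (\<forall>w y. w \<noteq> u \<longrightarrow> 0 \<le> y \<longrightarrow> y < N \<longrightarrow> s' 3 (w * N + y) = s 3 (w * N + y)) \<and>
       (u \<noteq> p \<longrightarrow> (\<forall>y. 0 \<le> y \<longrightarrow> y < N \<longrightarrow> s' 3 (u * N + y) = new_row s p u y)))"
    (is "runs _ _ _ _ ?Q")
proof -
  define I where "I x s' \<longleftrightarrow> (\<forall>Y. Y \<noteq> 3 \<longrightarrow> Y \<noteq> 9 \<longrightarrow> s' Y = s Y) \<and> (\<forall>a. s' 3 a = 0 \<or> s' 3 a = 1) \<and>
       (\<forall>w y. w \<noteq> u \<longrightarrow> 0 \<le> y \<longrightarrow> y < N \<longrightarrow> s' 3 (w * N + y) = s 3 (w * N + y)) \<and>
       (u \<noteq> p \<longrightarrow> (\<forall>y. 0 \<le> y \<longrightarrow> y < x \<longrightarrow> s' 3 (u * N + y) = new_row s p u y))" for x s'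
  have N: "s 0 0 = N" "s 1 = g" using s by (auto simp: safe_def)
  have "runs W (for_loop 9 (var 0) row_body) s ((n + 1) * (cost row_body + expr_time (var 0) + 10)) ?Q"
  proof (rule runs_for_loop[where I = I])
    show "I 0 (s(9 := (s 9)(0 := 0)))" using s by (simp add: I_def safe_def)
  next
    fix k s' assume "I k s'"
    then show "fits W s' (var 0) \<and> eval_expr s' (var 0) = N" using W_bounds N by (simp add: I_def)
  next
    fix x s' assume I: "I x s'" and x: "0 \<le> x" "x < N" "s' 9 0 = x"
    then have e: "s' 11 0 = u" "s' 12 0 = p" "s' 0 0 = N" "s' (Suc 0) = g" using s N by (simp_all add: I_def)
    have v01: "s' 3 a = 0 \<or> s' 3 a = 1" for a using I by (simp add: I_def)
    have prod01: "g a * g b * (1 - s' 3 c) = 0 \<or> g a * g b * (1 - s' 3 c) = 1" for a b c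
      using g01[of a] g01[of b] v01[of c] by auto
    have val: "\<bar>g a\<bar> \<le> W" "\<bar>g a * g b\<bar> \<le> W" "\<bar>s' 3 c\<bar> \<le> W" "\<bar>1 - s' 3 c\<bar> \<le> W"
      "\<bar>g a * g b * (1 - s' 3 c)\<bar> \<le> W" for a b c
      using g01[of a] g01[of b] v01[of c] W_bounds by auto
    have small: "\<bar>x\<bar> \<le> W" "\<bar>u\<bar> \<le> W" "\<bar>p\<bar> \<le> W" "\<bar>N\<bar> \<le> W" "\<bar>u * N\<bar> \<le> W" "\<bar>p * N\<bar> \<le> W"
      "\<bar>u * N + x\<bar> \<le> W" "\<bar>p * N + x\<bar> \<le> W" "\<bar>1\<bar> \<le> W" "0 \<le> W"
      using addr_bounds[OF u x(1,2)] addr_bounds[OF p x(1,2)] u p x W by linarith+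
    let ?s = "s'(3 := (s' 3)(u * N + x := g (u * N + x) * g (p * N + x) * (1 - s' 3 (p * N + x))))"
    have "u \<noteq> p \<longrightarrow> s' 3 (p * N + x) = s 3 (p * N + x)" using I x by (auto simp: I_def)
    then have "I (x + 1) (?s(9 := (?s 9)(0 := x + 1)))"
      using I x prod01 by (auto simp: I_def addr_eq_iff new_row_def)
    then show "runs W row_body s' (cost row_body) (\<lambda>s''. s'' 9 0 = x \<and> I (x + 1) (s''(9 := (s'' 9)(0 := x + 1))))"
      using x small val by (intro runs_wp) (simp add: row_body_def e)
  next
    fix s' assume "I N s'" then show "?Q s'" by (simp add: I_def)
  next
    show "N + 1 \<le> W" by (rule W_bounds)
  qed
  then show ?thesis by (rule runs_conseq) simp_all
qed

text \<open>Rewriting row \<open>u\<close> spoils no correct row: the other rows are untouched, and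
  row \<open>u\<close> is correct afterwards in any case.\<close>

lemma row_ok_expand:
  assumes R: "candidate R" "R p u" "row_ok R s p"
    and "s' 3 = (s\<^sub>1 3)(u * N + p := 1)"
    and other: "\<forall>w y. w \<noteq> u \<longrightarrow> 0 \<le> y \<longrightarrow> y < N \<longrightarrow> s\<^sub>1 3 (w * N + y) = s 3 (w * N + y)"
    and new: "\<forall>y. 0 \<le> y \<longrightarrow> y < N \<longrightarrow> s\<^sub>1 3 (u * N + y) = new_row s p u y"
  shows "row_ok R s' u" and "row_ok R s w \<Longrightarrow> row_ok R s' w"
proof -
  have p: "0 \<le> p" "p < N" using candidate_range[OF R(1,2)] by auto
  show u: "row_ok R s' u"
    unfolding row_ok_def
  proof (intro allI impI)
    fix x assume x: "0 \<le> x" "x < N"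
    have 1: "R u x \<longleftrightarrow> x = p \<or> g (u * N + x) = 1 \<and> g (p * N + x) = 1 \<and> \<not> R p x"
      using R(1,2) x unfolding candidate_def by blast
    have 2: "s 3 (p * N + x) = of_bool (R p x)" using R(3) x by (simp add: row_ok_def)
    show "s' 3 (u * N + x) = of_bool (R u x)"
      using g01[of "u * N + x"] g01[of "p * N + x"] new x
      by (auto simp: assms(4) addr_eq_iff p 1 2 new_row_def)
  qed
  show "row_ok R s' w" if "row_ok R s w"
  proof (cases "w = u")
    case False
    then show ?thesis using that other p by (simp add: row_ok_def assms(4) addr_eq_iff)
  qed (simp add: u)
qed

text \<open>The length bound counts at most \<open>N\<close> insertions per round. It is crude, but
  it is available on every input, whereas \<open>found\<close> gives injectivity of the queue only
  relative to a candidate.\<close>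

definition outer_inv :: "int \<Rightarrow> memory \<Rightarrow> bool" where
  "outer_inv h s \<longleftrightarrow> safe s \<and> 1 \<le> s 10 0 \<and> s 10 0 \<le> h * N + 1 \<and>
     (\<forall>R. candidate R \<longrightarrow> found R h 0 s)"

definition inner_inv :: "int \<Rightarrow> int \<Rightarrow> int \<Rightarrow> memory \<Rightarrow> bool" where
  "inner_inv h u x s \<longleftrightarrow> safe s \<and> 1 \<le> s 10 0 \<and> s 10 0 \<le> h * N + x + 1 \<and> s 8 0 = h \<and> s 11 0 = u \<and>
     (\<forall>R. candidate R \<longrightarrow> h < s 10 0 \<and> s 6 h = u \<and> row_ok R s u \<and> found R h x s)"

text \<open>Since \<open>x\<close> is unvisited, it does not occur in the queue. Appending it
  therefore keeps the queue injective, and recording its parent overwrites the parent of no queue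
  entry.\<close>

lemma found_discover:
  assumes f: "found R h x s" and h: "0 \<le> h" "h < s 10 0" and x: "0 \<le> x" "x < N"
    and u: "s 6 h = u" "R u x" "s 5 x \<noteq> 1" "row_ok R s u"
    and s': "s' 3 = s 3" "s' 5 = (s 5)(x := 1)" "s' 6 = (s 6)(s 10 0 := x)" "s' 7 = (s 7)(x := u)"
      "s' 10 0 = s 10 0 + 1"
  shows "found R h (x + 1) s'"
proof -
  let ?t = "s 10 0"
  note t = foundD(1,2)[OF f]
  have row: "row_ok R s' = row_ok R s" by (simp add: fun_eq_iff row_ok_def s')
  have x_new: "x \<notin> s 6 ` {0..<?t}" using found_visited[OF f x] u(3) by simp
  have old: "s' 6 i = s 6 i" if "i < ?t" for i using that by (simp add: s')
  have ivl: "{0..<?t + 1} = insert ?t {0..<?t}" using t by auto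
  have img: "s' 6 ` {0..<?t + 1} = insert x (s 6 ` {0..<?t})"
    by (auto simp: ivl s')
  have not_x: "s 6 i \<noteq> x" if "0 \<le> i" "i < ?t" for i using x_new that by auto
  have visited: "s' 5 y = 1" if "s 5 y = 1" for y using that by (simp add: s')
  show ?thesis
  proof (rule foundI, unfold row s'(5))
    show "inj_on (s' 6) {0..<?t + 1}"
    proof (rule inj_onI)
      fix i j assume "i \<in> {0..<?t + 1}" "j \<in> {0..<?t + 1}" "s' 6 i = s' 6 j"
      then show "i = j"
        using not_x[of i] not_x[of j] inj_onD[OF found_inj[OF f], of i j]
        by (cases "i = ?t"; cases "j = ?t") (auto simp: s')
    qed
    show "s' 5 y = 1 \<longleftrightarrow> y \<in> s' 6 ` {0..<?t + 1}" if "0 \<le> y" "y < N" for y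
      using found_visited[OF f that] unfolding img by (simp add: s')
    show "row_ok R s (s' 6 i)" if "0 \<le> i" "i < h" for i
      using found_row[OF f that] that h by (simp add: old)
    show "s' 5 y = 1" if "0 \<le> i" "i < h" "R (s' 6 i) y" for i y
      using found_closed[OF f that(1,2)] that(2,3) h by (intro visited) (simp add: old)
    show "s' 5 y = 1" if "0 \<le> y" "y < x + 1" "R (s' 6 h) y" for y
    proof (cases "y = x")
      case False
      then show ?thesis using found_partial[OF f that(1)] that h by (intro visited) (simp add: old)
    qed (simp add: s')
    show "R (s' 7 (s' 6 i)) (s' 6 i)" if "0 < i" "i < ?t + 1" for i
      using found_parent(1)[OF f that(1)] that u not_x[of i] by (cases "i = ?t") (simp_all add: s')
    show "row_ok R s (s' 7 (s' 6 i))" if "0 < i" "i < ?t + 1" for i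
      using found_parent(2)[OF f that(1)] that u not_x[of i] by (cases "i = ?t") (simp_all add: s')
  qed (use t foundD(3,6)[OF f] in \<open>simp_all add: old\<close>)
qed

lemma runs_discover:
  assumes s: "inner_inv h u 0 s" and h: "0 \<le> h" "h < N" and u: "0 \<le> u" "u < N"
  shows "runs W (for_loop 9 (var 0) discover_body) s ((n + 1) * (cost discover_body + 12))
    (inner_inv h u N)"
proof -
  have "runs W (for_loop 9 (var 0) discover_body) s
      ((n + 1) * (cost discover_body + expr_time (var 0) + 10)) (inner_inv h u N)"
  proof (rule runs_for_loop[where I = "inner_inv h u"])
    show "inner_inv h u 0 (s(9 := (s 9)(0 := 0)))"
      using s by (simp add: inner_inv_def)
  next
    fix k s' assume "inner_inv h u k s'"
    then show "fits W s' (var 0) \<and> eval_expr s' (var 0) = N"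
      using W_bounds by (simp add: inner_inv_def safe_def)
  next
    fix x s' assume I: "inner_inv h u x s'" and x: "0 \<le> x" "x < N" "s' 9 0 = x"
    then have e: "s' 11 0 = u" "s' 0 0 = N" "safe s'" "s' 8 0 = h" by (simp_all add: inner_inv_def safe_def)
    have v01: "s' 3 a = 0 \<or> s' 3 a = 1" "s' 5 a = 0 \<or> s' 5 a = 1" for a
      using e(3) by (simp_all add: safe_def)
    have v: "\<bar>s' 3 a\<bar> \<le> W" "\<bar>s' 5 a\<bar> \<le> W" for a
      using v01[of a] W_bounds by auto
    have "s' 10 0 \<le> N * N + 1" "1 \<le> s' 10 0"
      using I addr_bounds[OF h x(1,2)] by (auto simp: inner_inv_def)
    then have small: "\<bar>x\<bar> \<le> W" "\<bar>u\<bar> \<le> W" "\<bar>N\<bar> \<le> W" "\<bar>u * N\<bar> \<le> W" "\<bar>u * N + x\<bar> \<le> W" "\<bar>1\<bar> \<le> W" "0 \<le> W"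
      "\<bar>s' 10 0\<bar> \<le> W" "\<bar>s' 10 0 + 1\<bar> \<le> W"
      using addr_bounds[OF u x(1,2)] u x W by linarith+
    let ?s = "s'(5 := (s' 5)(x := 1), 6 := (s' 6)(s' 10 0 := x), 7 := (s' 7)(x := u),
      10 := (s' 10)(0 := s' 10 0 + 1))"
    have less: "s' 5 x < s' 3 (u * N + x) \<longleftrightarrow> s' 3 (u * N + x) = 1 \<and> s' 5 x \<noteq> 1"
      using v01(1)[of "u * N + x"] v01(2)[of x] by auto
    have found: "inner_inv h u (x + 1) (?s(9 := (?s 9)(0 := x + 1)))"
      if lt: "s' 5 x < s' 3 (u * N + x)"
    proof -
      have "safe (?s(9 := (?s 9)(0 := x + 1)))" using e(3) x u by (auto simp: safe_def)
      moreover have "h < s' 10 0 + 1 \<and> (?s 6) h = u \<and> row_ok R (?s(9 := (?s 9)(0 := x + 1))) u \<and>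
          found R h (x + 1) (?s(9 := (?s 9)(0 := x + 1)))" if R: "candidate R" for R
      proof -
        have 1: "h < s' 10 0" "s' 6 h = u" "row_ok R s' u" "found R h x s'"
          using I R by (auto simp: inner_inv_def)
        moreover have "R u x" using 1(3) lt less x by (simp add: row_ok_def)
        moreover have "found R h (x + 1) (?s(9 := (?s 9)(0 := x + 1)))"
          using lt less h x 1 \<open>R u x\<close> by (intro found_discover[where s = s' and u = u]) auto
        ultimately show ?thesis by (simp add: row_ok_def)
      qed
      ultimately show ?thesis using I by (simp add: inner_inv_def)
    qed
    have skip: "inner_inv h u (x + 1) (s'(9 := (s' 9)(0 := x + 1)))"
      if lt: "\<not> s' 5 x < s' 3 (u * N + x)"
    proof -
      have "found R h (x + 1) s'" if R: "candidate R" for R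
      proof -
        have 1: "s' 6 h = u" "row_ok R s' u" "found R h x s'"
          using I R by (auto simp: inner_inv_def)
        have part: "s' 5 y = 1" if "0 \<le> y" "y < x + 1" "R u y" for y
        proof (cases "y = x")
          case True
          then show ?thesis using that(3) 1(2) lt less x by (simp add: row_ok_def)
        next
          case False
          then show ?thesis using found_partial[OF 1(3) that(1)] that 1(1) by simp
        qed
        show ?thesis
          by (rule foundI) (use foundD[OF 1(3)] part 1(1) in simp_all)
      qed
      then have "found R h (x + 1) (s'(9 := (s' 9)(0 := x + 1)))" if "candidate R" for R
        using that by simp
      then show ?thesis using I by (simp add: inner_inv_def safe_def row_ok_def)
    qed
    show "runs W discover_body s' (cost discover_body)
        (\<lambda>s''. s'' 9 0 = x \<and> inner_inv h u (x + 1) (s''(9 := (s'' 9)(0 := x + 1))))"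
      using x small v found skip by (intro runs_wp) (simp add: discover_body_def e)
  next
    show "N + 1 \<le> W" by (rule W_bounds)
  qed
  then show ?thesis by (rule runs_conseq) simp_all
qed

lemma runs_expand:
  assumes I: "outer_inv h s" and h: "0 < h" "h < N" "s 8 0 = h"
    and u: "s 11 0 = s 6 h" and p: "s 12 0 = s 7 (s 6 h)"
  shows "runs W expand_row s (1 + (n + 1) * (cost row_body + 12) + cost (Write 3 (addr (var 11) (var 12)) (Const 1)))
    (inner_inv h (s 6 h) 0)"
  unfolding expand_row_def
proof (rule runs_Seq)
  define u p where "u = s 6 h" and "p = s 7 (s 6 h)"
  have s: "safe s" using I by (simp add: outer_inv_def)
  then have b: "0 \<le> u" "u < N" "0 \<le> p" "p < N" by (simp_all add: safe_def u_def p_def)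
  show "runs W (for_loop 9 (var 0) row_body) s ((n + 1) * (cost row_body + 12))
    (\<lambda>s'. (\<forall>Y. Y \<noteq> 3 \<longrightarrow> Y \<noteq> 9 \<longrightarrow> s' Y = s Y) \<and> (\<forall>a. s' 3 a = 0 \<or> s' 3 a = 1) \<and>
       (\<forall>w y. w \<noteq> u \<longrightarrow> 0 \<le> y \<longrightarrow> y < N \<longrightarrow> s' 3 (w * N + y) = s 3 (w * N + y)) \<and>
       (u \<noteq> p \<longrightarrow> (\<forall>y. 0 \<le> y \<longrightarrow> y < N \<longrightarrow> s' 3 (u * N + y) = new_row s p u y)))"
    using runs_row_loop[OF s _ _ b] assms by (simp add: u_def p_def)
  fix s' assume A: "(\<forall>Y. Y \<noteq> 3 \<longrightarrow> Y \<noteq> 9 \<longrightarrow> s' Y = s Y) \<and> (\<forall>a. s' 3 a = 0 \<or> s' 3 a = 1) \<and>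
       (\<forall>w y. w \<noteq> u \<longrightarrow> 0 \<le> y \<longrightarrow> y < N \<longrightarrow> s' 3 (w * N + y) = s 3 (w * N + y)) \<and>
       (u \<noteq> p \<longrightarrow> (\<forall>y. 0 \<le> y \<longrightarrow> y < N \<longrightarrow> s' 3 (u * N + y) = new_row s p u y))"
  then have frame: "s' Y = s Y" if "Y \<noteq> 3" "Y \<noteq> 9" for Y using that by blast
  let ?s = "s'(3 := (s' 3)(u * N + p := 1))"
  have e: "s' 11 0 = u" "s' 12 0 = p" "s' 0 0 = N"
    using s u p by (auto simp: frame u_def p_def safe_def)
  have "safe ?s" using s A by (simp add: safe_def frame)
  moreover have "h < s 10 0 \<and> row_ok R ?s u \<and> found R h 0 ?s" if R: "candidate R" for R
  proof -
    have f: "found R h 0 s" using I R by (simp add: outer_inv_def)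
    \<comment> \<open>Only a candidate guarantees that entry \<open>h\<close> exists. As
      \<open>h\<close> is positive, this entry has a recorded parent with a correct row, and
      irreflexivity of \<open>R\<close> then discharges the guard of the row loop.\<close>
    from found_nonempty[OF R f] h have ht: "h < s 10 0" by simp
    then have pu: "R p u" "row_ok R s p" using found_parent[OF f h(1) ht] by (simp_all add: u_def p_def)
    then have "u \<noteq> p" using candidate_range[OF R] by blast
    then have other: "\<forall>w y. w \<noteq> u \<longrightarrow> 0 \<le> y \<longrightarrow> y < N \<longrightarrow> s' 3 (w * N + y) = s 3 (w * N + y)"
      and new: "\<forall>y. 0 \<le> y \<longrightarrow> y < N \<longrightarrow> s' 3 (u * N + y) = new_row s p u y" using A by auto
    have s3: "?s 3 = (s' 3)(u * N + p := 1)" by simp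
    note rows = row_ok_expand[where s' = ?s and s\<^sub>1 = s', OF R pu s3 other new]
    have "found R h 0 ?s"
      by (rule foundI) (use foundD[OF f] rows(2) in \<open>simp_all add: frame\<close>)
    with rows(1) ht show ?thesis by blast
  qed
  ultimately have "inner_inv h u 0 ?s"
    using I h u by (simp add: inner_inv_def outer_inv_def frame u_def)
  moreover have "\<bar>u\<bar> \<le> W" "\<bar>p\<bar> \<le> W" "\<bar>N\<bar> \<le> W" "\<bar>u * N\<bar> \<le> W" "\<bar>u * N + p\<bar> \<le> W" "1 \<le> W" "0 \<le> W"
    using addr_bounds[OF b] b W by linarith+
  ultimately show "runs W (Write 3 (addr (var 11) (var 12)) (Const 1)) s'
      (cost (Write 3 (addr (var 11) (var 12)) (Const 1))) (inner_inv h (s 6 h) 0)"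
    by (intro runs_wp) (simp add: e flip: u_def)
qed

lemma runs_search_body:
  assumes I: "outer_inv h s" and h: "0 \<le> h" "h < N" "s 8 0 = h"
  shows "runs W search_body s (search_body_time n)
    (\<lambda>s'. s' 8 0 = h \<and> outer_inv (h + 1) (s'(8 := (s' 8)(0 := h + 1))))"
  unfolding search_body_def search_body_time_def
proof (rule runs_Seq)
  define u p where "u = s 6 h" and "p = s 7 (s 6 h)"
  have s: "safe s" using I by (simp add: outer_inv_def)
  then have b: "0 \<le> u" "u < N" "0 \<le> p" "p < N" by (simp_all add: safe_def u_def p_def)
  let ?s = "s(11 := (s 11)(0 := u), 12 := (s 12)(0 := p))"
  show "runs W (Seq (Write 11 (Const 0) (Read 6 (var 8))) (Write 12 (Const 0) (Read 7 (var 11)))) s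
      (cost (Seq (Write 11 (Const 0) (Read 6 (var 8))) (Write 12 (Const 0) (Read 7 (var 11))))) (\<lambda>s'. s' = ?s)"
    using b h W_bounds by (intro runs_wp) (simp add: u_def p_def)
  fix s' assume s': "s' = ?s"
  have I': "outer_inv h s'"
    using I unfolding s' by (simp add: outer_inv_def)
  have e: "s' 8 0 = h" "s' 11 0 = u" "s' 12 0 = p" "s' 6 h = u" "s' 7 u = p"
    using h(3) by (simp_all add: s' u_def p_def)
  show "runs W (Seq (IfLess (Const 0) (var 8) expand_row Skip) (for_loop 9 (var 0) discover_body)) s'
      (1 + (4 + expand_time n) + (n + 1) * (cost discover_body + 12))
      (\<lambda>s'. s' 8 0 = h \<and> outer_inv (h + 1) (s'(8 := (s' 8)(0 := h + 1))))"
  proof (rule runs_Seq)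
    have "runs W (IfLess (Const 0) (var 8) expand_row Skip) s'
        (1 + expr_time (Const 0) + expr_time (var 8) + expand_time n) (inner_inv h u 0)"
    proof (rule runs_IfLess)
      show "fits W s' (Const 0)" "fits W s' (var 8)" using e h W_bounds by auto
      show "runs W expand_row s' (expand_time n) (inner_inv h u 0)"
        if "eval_expr s' (Const 0) < eval_expr s' (var 8)"
        using runs_expand[OF I'] that h e unfolding expand_time_def by simp
      show "runs W Skip s' (expand_time n) (inner_inv h u 0)"
        if "\<not> eval_expr s' (Const 0) < eval_expr s' (var 8)"
      proof -
        have 0: "h = 0" using that e h by simp
        have "inner_inv h u 0 s'"
          using I' e v 0 foundD(1,3,6)[of _ 0 0 s'] by (force simp: inner_inv_def outer_inv_def)
        then have "runs W Skip s' (cost Skip) (inner_inv h u 0)" by (intro runs_wp) simp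
        then show ?thesis by (rule runs_conseq) (simp_all add: expand_time_def)
      qed
    qed
    then show "runs W (IfLess (Const 0) (var 8) expand_row Skip) s' (4 + expand_time n) (inner_inv h u 0)"
      by (rule runs_conseq) simp_all
  next
    fix s'' assume "inner_inv h u 0 s''"
    from runs_discover[OF this h(1,2) b(1,2)]
    show "runs W (for_loop 9 (var 0) discover_body) s'' ((n + 1) * (cost discover_body + 12))
        (\<lambda>s'. s' 8 0 = h \<and> outer_inv (h + 1) (s'(8 := (s' 8)(0 := h + 1))))"
    proof (rule runs_conseq)
      fix t assume J: "inner_inv h u N t"
      have "found R (h + 1) 0 t" if R: "candidate R" for R
      proof -
        have f: "h < t 10 0" "t 6 h = u" "row_ok R t u" "found R h N t"
          using J R by (auto simp: inner_inv_def)
        show ?thesis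
        proof (rule foundI)
          show "row_ok R t (t 6 i)" if "0 \<le> i" "i < h + 1" for i
            using f(2,3) found_row[OF f(4) that(1)] that(2) by (cases "i = h") auto
          \<comment> \<open>For entry \<open>h\<close>, the inner loop has covered all numbers below
            \<open>N\<close>, and \<open>R\<close> relates no others.\<close>
          show "t 5 y = 1" if y: "0 \<le> i" "i < h + 1" "R (t 6 i) y" for i y
          proof (cases "i = h")
            case True
            have "0 \<le> y" "y < N" using candidate_range[OF R y(3)] by auto
            then show ?thesis using found_partial[OF f(4)] True y(3) by simp
          next
            case False
            then show ?thesis using found_closed[OF f(4) y(1) _ y(3)] y(2) by simp
          qed
        qed (use f(1) foundD[OF f(4)] in auto)
      qed
      then have "found R (h + 1) 0 (t(8 := (t 8)(0 := h + 1)))" if "candidate R" for R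
        using that by simp
      then show "t 8 0 = h \<and> outer_inv (h + 1) (t(8 := (t 8)(0 := h + 1)))"
        using J by (simp add: outer_inv_def inner_inv_def safe_def algebra_simps)
    qed simp
  qed
qed

lemma runs_search:
  assumes s: "safe s" "\<And>a. s 5 a = 0" "\<And>a. s 6 a = 0"
  shows "runs W search s (search_time n)
    (\<lambda>s'. safe s' \<and> (\<forall>R. candidate R \<longrightarrow> (\<forall>u. 0 \<le> u \<longrightarrow> u < N \<longrightarrow> row_ok R s' u)))"
  unfolding search_def search_time_def
proof (rule runs_Seq[where R = "outer_inv 0"])
  let ?init = "Seq (Write 5 (Read 0 (Const 1)) (Const 1)) (Seq (Write 6 (Const 0) (Read 0 (Const 1)))
       (Write 10 (Const 0) (Const 1)))"
  define I where "I x s' \<longleftrightarrow> safe s' \<and> s' 10 0 = 1 \<and> s' 6 0 = v \<and> (\<forall>y. s' 5 y = of_bool (y = v)) \<and>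
    (\<forall>y. 0 \<le> y \<longrightarrow> y < x \<longrightarrow> s' 3 (v * N + y) = U y)" for x s'
  show "runs W (Seq ?init (for_loop 9 (var 0) start_body)) s
      (1 + 13 + (n + 1) * (cost start_body + 12)) (outer_inv 0)"
  proof (rule runs_Seq)
    have "\<bar>N\<bar> \<le> W" "\<bar>v\<bar> \<le> W" "1 \<le> W" using v W_bounds by linarith+
    moreover have "I 0 (s(5 := (s 5)(v := 1), 6 := (s 6)(0 := v), 10 := (s 10)(0 := 1)))"
      using s v by (auto simp: I_def safe_def)
    moreover have "s 0 1 = v" using s(1) by (simp add: safe_def)
    ultimately have "runs W ?init s (cost ?init) (I 0)" by (intro runs_wp) simp
    then show "runs W ?init s 13 (I 0)" by (rule runs_conseq) simp_all
  next
    fix s\<^sub>0 assume s\<^sub>0: "I 0 s\<^sub>0"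
    have "runs W (for_loop 9 (var 0) start_body) s\<^sub>0
        ((n + 1) * (cost start_body + expr_time (var 0) + 10)) (outer_inv 0)"
    proof (rule runs_for_loop[where I = I])
      show "I 0 (s\<^sub>0(9 := (s\<^sub>0 9)(0 := 0)))" using s\<^sub>0 by (simp add: I_def safe_def)
    next
      fix k s' assume "I k s'"
      then show "fits W s' (var 0) \<and> eval_expr s' (var 0) = N"
        using W_bounds by (simp add: I_def safe_def)
    next
      fix x s' assume I: "I x s'" and x: "0 \<le> x" "x < N" "s' 9 0 = x"
      then have e: "s' 0 0 = N" "s' 0 1 = v" "s' 2 = U" by (simp_all add: I_def safe_def)
      let ?s = "s'(3 := (s' 3)(v * N + x := U x))"
      have "I (x + 1) (?s(9 := (?s 9)(0 := x + 1)))"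
        using I x U01 by (auto simp: I_def safe_def)
      moreover have "\<bar>U a\<bar> \<le> W" for a using U01[of a] W_bounds by auto
      moreover have "\<bar>v * N\<bar> \<le> W" "\<bar>v * N + x\<bar> \<le> W" "\<bar>v\<bar> \<le> W" "\<bar>N\<bar> \<le> W" "\<bar>x\<bar> \<le> W" "1 \<le> W" "0 \<le> W"
        using addr_bounds[OF v x(1,2)] v x W by linarith+
      ultimately show "runs W start_body s' (cost start_body)
          (\<lambda>s''. s'' 9 0 = x \<and> I (x + 1) (s''(9 := (s'' 9)(0 := x + 1))))"
        using x by (intro runs_wp) (simp add: start_body_def e)
    next
      fix s' assume I: "I N s'"
      have "found R 0 0 s'" if "candidate R" for R
      proof (rule foundI)
        show "s' 5 y = 1 \<longleftrightarrow> y \<in> s' 6 ` {0..<s' 10 0}" if "0 \<le> y" "y < N" for y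
        proof -
          have "{0..<1::int} = {0}" by auto
          then show ?thesis using I by (simp add: I_def)
        qed
      qed (use I candidate_start[OF that] v in \<open>auto simp: I_def row_ok_def inj_on_def\<close>)
      then show "outer_inv 0 s'" using I by (simp add: outer_inv_def I_def)
    next
      show "N + 1 \<le> W" by (rule W_bounds)
    qed
    then show "runs W (for_loop 9 (var 0) start_body) s\<^sub>0 ((n + 1) * (cost start_body + 12)) (outer_inv 0)"
      by (rule runs_conseq) simp_all
  qed
next
  fix s\<^sub>0 assume s\<^sub>0: "outer_inv 0 s\<^sub>0"
  have "runs W (for_loop 8 (var 0) search_body) s\<^sub>0 ((n + 1) * (search_body_time n + expr_time (var 0) + 10))
    (\<lambda>s'. safe s' \<and> (\<forall>R. candidate R \<longrightarrow> (\<forall>u. 0 \<le> u \<longrightarrow> u < N \<longrightarrow> row_ok R s' u)))"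
  proof (rule runs_for_loop[where I = outer_inv])
    show "outer_inv 0 (s\<^sub>0(8 := (s\<^sub>0 8)(0 := 0)))"
      using s\<^sub>0 by (simp add: outer_inv_def)
  next
    fix k s' assume "outer_inv k s'"
    then show "fits W s' (var 0) \<and> eval_expr s' (var 0) = N"
      using W_bounds by (simp add: outer_inv_def safe_def)
  next
    fix h s' assume "outer_inv h s'" "0 \<le> h" "h < N" "s' 8 0 = h"
    then show "runs W search_body s' (search_body_time n)
        (\<lambda>s''. s'' 8 0 = h \<and> outer_inv (h + 1) (s''(8 := (s'' 8)(0 := h + 1))))"
      by (rule runs_search_body)
  next
    fix s' assume "outer_inv N s'"
    then show "safe s' \<and> (\<forall>R. candidate R \<longrightarrow> (\<forall>u. 0 \<le> u \<longrightarrow> u < N \<longrightarrow> row_ok R s' u))"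
      using found_complete by (auto simp: outer_inv_def)
  next
    show "N + 1 \<le> W" by (rule W_bounds)
  qed
  then show "runs W (for_loop 8 (var 0) search_body) s\<^sub>0 ((n + 1) * (search_body_time n + 12))
    (\<lambda>s'. safe s' \<and> (\<forall>R. candidate R \<longrightarrow> (\<forall>u. 0 \<le> u \<longrightarrow> u < N \<longrightarrow> row_ok R s' u)))"
    by (rule runs_conseq) simp_all
qed

end

section \<open>Verifying the candidate\<close>

text \<open>Division with remainder matches the addresses below \<open>n * n\<close> with index
  pairs, so packing a bank into a matrix and storing it again only clears the other cells. This
  identifies copied banks with the operands of \<open>mult_input\<close>.\<close>

lemma matrix_bank_mat:
  "matrix_bank n (mat n n (\<lambda>(i, j). m (int i * int n + int j))) a =
     (if 0 \<le> a \<and> a < int n * int n then m a else 0)"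
proof (cases "0 \<le> a \<and> a < int n * int n")
  case True
  then obtain b where a: "a = int b" by (auto elim: nonneg_int_cases)
  with True have b: "b < n * n" by (simp flip: of_nat_mult)
  then have "0 < n" by (cases n) auto
  then have "b div n < n" "b mod n < n" using b by (auto simp: less_mult_imp_div_less)
  moreover have "int (b div n) * int n + int (b mod n) = int b"
    by (metis div_mult_mod_eq of_nat_add of_nat_mult)
  ultimately show ?thesis using True b by (simp add: matrix_bank_def a flip: of_nat_mult)
qed (auto simp: matrix_bank_def simp flip: of_nat_mult)

text \<open>The entry counts the middle vertices of walks of length 2 from \<open>i\<close> to
  \<open>j\<close>.\<close>

lemma mat01_square:
  fixes A :: "int mat"
  assumes "A \<in> carrier_mat n n" and A: "\<And>i j. i < n \<Longrightarrow> j < n \<Longrightarrow> A $$ (i, j) = 0 \<or> A $$ (i, j) = 1"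
    and ij: "i < n" "j < n"
  shows "0 \<le> (A * A) $$ (i, j)" "(A * A) $$ (i, j) \<le> int n"
    "0 < (A * A) $$ (i, j) \<longleftrightarrow> (\<exists>k<n. A $$ (i, k) = 1 \<and> A $$ (k, j) = 1)"
proof -
  have eq: "(A * A) $$ (i, j) = (\<Sum>k<n. A $$ (i, k) * A $$ (k, j))"
    using assms by (auto simp: scalar_prod_def atLeast0LessThan)
  have term01: "A $$ (i, k) * A $$ (k, j) = of_bool (A $$ (i, k) = 1 \<and> A $$ (k, j) = 1)" if "k < n" for k
    using A[OF ij(1) that] A[OF that ij(2)] by auto
  have "(A * A) $$ (i, j) = (\<Sum>k<n. of_bool (A $$ (i, k) = 1 \<and> A $$ (k, j) = 1))"
    unfolding eq by (intro sum.cong) (auto simp: term01)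
  also have "\<dots> = int (card {k \<in> {..<n}. A $$ (i, k) = 1 \<and> A $$ (k, j) = 1})"
    by (simp add: Int_def)
  finally have card: "(A * A) $$ (i, j) = int (card {k \<in> {..<n}. A $$ (i, k) = 1 \<and> A $$ (k, j) = 1})" .
  have "card {k \<in> {..<n}. A $$ (i, k) = 1 \<and> A $$ (k, j) = 1} \<le> card {..<n}"
    by (intro card_mono) auto
  then show "0 \<le> (A * A) $$ (i, j)" "(A * A) $$ (i, j) \<le> int n"
    "0 < (A * A) $$ (i, j) \<longleftrightarrow> (\<exists>k<n. A $$ (i, k) = 1 \<and> A $$ (k, j) = 1)"
    unfolding card by (auto simp: card_gt_0_iff)
qed

lemma runs_multiply:
  assumes P: "\<And>A B. A \<in> carrier_mat n n \<Longrightarrow> B \<in> carrier_mat n n \<Longrightarrow>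
      \<forall>i<n. \<forall>j<n. \<bar>A $$ (i, j)\<bar> \<le> int n ^ d \<and> \<bar>B $$ (i, j)\<bar> \<le> int n ^ d \<Longrightarrow>
      \<exists>t s. exec W' P (mult_input n A B) t s \<and> t \<le> M \<and> bank_holds n (A * B) (s 3)"
    and "W' \<le> W" and "inj f"
    and A: "A \<in> carrier_mat n n" "\<And>i j. i < n \<Longrightarrow> j < n \<Longrightarrow> A $$ (i, j) = 0 \<or> A $$ (i, j) = 1"
    and s: "(\<lambda>X. s (f X)) = mult_input n A A"
  shows "runs W (rename_prog f P) s M
    (\<lambda>s'. bank_holds n (A * A) (s' (f 3)) \<and> (\<forall>Y. Y \<notin> range f \<longrightarrow> s' Y = s Y))"
proof -
  have "\<bar>A $$ (i, j)\<bar> \<le> int n ^ d" if "i < n" "j < n" for i j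
  proof -
    \<comment> \<open>An index below \<open>n\<close> exists, so \<open>n\<close> is positive and
      0-1 entries are admissible for every \<open>d\<close>, including 0.\<close>
    have "1 \<le> int n ^ d" using that by (intro one_le_power) simp
    then show ?thesis using A(2)[OF that] by auto
  qed
  then obtain t s' where "exec W' P (mult_input n A A) t s'" "t \<le> M" "bank_holds n (A * A) (s' 3)"
    using P[OF A(1) A(1)] by blast
  moreover from exec_rename_prog[OF exec_mono[OF this(1) \<open>W' \<le> W\<close>] \<open>inj f\<close> s]
  obtain m' where m': "exec W (rename_prog f P) s t m'" "(\<lambda>X. m' (f X)) = s'"
    "\<forall>Y. Y \<notin> range f \<longrightarrow> m' Y = s Y" by blast
  moreover from m'(2) have "m' (f 3) = s' 3" by (rule fun_cong)
  ultimately show ?thesis unfolding runs_def by auto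
qed

section \<open>Code of the verification\<close>

text \<open>Opposite parities keep the two calls apart, so the second finds its work banks untouched
  by the first. The dimension, the operands and the product are in banks 20, 22, 24 and 26 for the
  first call and in 21, 23, 25 and 27 for the second.\<close>

abbreviation bank\<^sub>1 :: "nat \<Rightarrow> nat" where "bank\<^sub>1 X \<equiv> 2 * X + 20"
abbreviation bank\<^sub>2 :: "nat \<Rightarrow> nat" where "bank\<^sub>2 X \<equiv> 2 * X + 21"

lemma not_in_range_bank\<^sub>1: "Y < 20 \<or> odd Y \<Longrightarrow> Y \<notin> range bank\<^sub>1"
  by auto

lemma not_in_range_bank\<^sub>2: "Y < 21 \<or> even Y \<Longrightarrow> Y \<notin> range bank\<^sub>2"
  by auto

definition copy_body :: prog where
  "copy_body = Seq (Write 22 (var 8) (Read 3 (var 8))) (Write 24 (var 8) (Read 3 (var 8)))"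

definition load_root :: prog where
  "load_root = Seq (Write 20 (Const 0) (var 0)) (for_loop 8 (Mul (var 0) (var 0)) copy_body)"

text \<open>Zeros need no write, because banks 15, 23 and 25 are still zero when the first product
  is scanned.\<close>

definition support_body :: prog where
  "support_body = IfLess (Const 0) (Read 26 (var 8))
     (Seq (Write 15 (var 8) (Const 1)) (Seq (Write 23 (var 8) (Const 1)) (Write 25 (var 8) (Const 1))))
     Skip"

definition load_support :: prog where
  "load_support = Seq (Write 21 (Const 0) (var 0)) (for_loop 8 (Mul (var 0) (var 0)) support_body)"

abbreviation sq :: "expr \<Rightarrow> expr" where
  "sq e \<equiv> Mul e e"

text \<open>
  A sum of nonnegative terms, one for each condition on the entry \<open>(i, j)\<close>: symmetry, no triangle,
  \<open>H\<^sup>2 = G\<close> (the factor \<open>i - j\<close> exempts the diagonal), no 5-cycle, and the prescribed neighbourhood.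
  It vanishes iff all of them hold. Bank 15 keeps the support of the square, as the second
  multiplication may overwrite its input.
\<close>

definition penalty :: expr where
  "penalty = Add (Add (Add (Add
     (sq (Sub (Read 3 (var 8)) (Read 3 (addr (var 12) (var 11)))))
     (Mul (Read 3 (var 8)) (Read 15 (var 8))))
     (sq (Mul (Sub (var 11) (var 12)) (Sub (Sub (Read 1 (var 8)) (Read 15 (var 8))) (Read 3 (var 8))))))
     (Mul (Read 27 (var 8)) (Read 3 (var 8))))
     (sq (Sub (Read 3 (addr (Read 0 (Const 1)) (var 12))) (Read 2 (var 12))))"

text \<open>Expressions have division but no remainder, so the column is obtained by subtraction.
  The verdict starts at 1 and is only ever lowered.\<close>

definition check_body :: prog where
  "check_body = Seq (Write 11 (Const 0) (Div (var 8) (var 0)))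
     (Seq (Write 12 (Const 0) (Sub (var 8) (Mul (var 11) (var 0))))
       (IfLess (Const 0) penalty (Write 4 (Const 0) (Const 0)) Skip))"

definition check :: prog where
  "check = Seq (Write 4 (Const 0) (Const 1)) (for_loop 8 (Mul (var 0) (var 0)) check_body)"

section \<open>Correctness of the verification loops\<close>

context search_instance
begin

definition clip :: "(int \<Rightarrow> int) \<Rightarrow> int \<Rightarrow> int" where
  "clip m a = (if 0 \<le> a \<and> a < N * N then m a else 0)"

lemma div_mod_bounds:
  assumes "0 \<le> a" "a < N * N"
  shows "0 \<le> a div N" "a div N < N" "0 \<le> a mod N" "a mod N < N"
proof -
  have "0 < N" using v by simp
  then show "0 \<le> a div N" "0 \<le> a mod N" "a mod N < N"
    using assms(1) by (simp_all add: pos_imp_zdiv_nonneg_iff)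
  have "a div N * N \<le> a" using \<open>0 \<le> a mod N\<close> div_mult_mod_eq[of a N] by linarith
  then have "a div N * N < N * N" using assms(2) by linarith
  then show "a div N < N" using \<open>0 < N\<close> by simp
qed

text \<open>The constant 15 is the loop overhead 10 plus the 5 steps that evaluate
  \<open>Mul (var 0) (var 0)\<close>.\<close>

lemma runs_square_loop:
  assumes "I 0 (s(8 := (s 8)(0 := 0)))"
    and "\<And>k s. I k s \<Longrightarrow> s 0 0 = N"
    and "\<And>k s. I k s \<Longrightarrow> 0 \<le> k \<Longrightarrow> k < N * N \<Longrightarrow> s 8 0 = k \<Longrightarrow>
      wp W p (\<lambda>s'. s' 8 0 = k \<and> I (k + 1) (s'(8 := (s' 8)(0 := k + 1)))) s"
    and "\<And>s. I (N * N) s \<Longrightarrow> Q s"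
  shows "runs W (for_loop 8 (Mul (var 0) (var 0)) p) s ((n * n + 1) * (cost p + 15)) Q"
proof -
  have "runs W (for_loop 8 (Mul (var 0) (var 0)) p) s
      ((n * n + 1) * (cost p + expr_time (Mul (var 0) (var 0)) + 10)) Q"
  proof (rule runs_for_loop[where I = I])
    show "fits W s (Mul (var 0) (var 0)) \<and> eval_expr s (Mul (var 0) (var 0)) = int (n * n)"
      if "I k s" for k s using assms(2)[OF that] W_bounds by simp
    show "runs W p s (cost p) (\<lambda>s'. s' 8 0 = k \<and> I (k + 1) (s'(8 := (s' 8)(0 := k + 1))))"
      if "I k s" "0 \<le> k" "k < int (n * n)" "s 8 0 = k" for k s
      using assms(3)[OF that(1,2) _ that(4)] that(3) by (intro runs_wp) simp
    show "Q t" if "I (int (n * n)) t" for t using assms(4)[of t] that by simp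
    show "I 0 (s(8 := (s 8)(0 := 0)))" by fact
    show "int (n * n) + 1 \<le> W" using W_bounds by simp
  qed
  then show ?thesis by (rule runs_conseq) simp_all
qed

lemma runs_load_root:
  assumes s: "safe s"
  shows "runs W load_root s (1 + 4 + (n * n + 1) * (cost copy_body + 15))
    (\<lambda>s'. s' 20 = (\<lambda>_. 0)(0 := N) \<and> s' 22 = clip (s 3) \<and> s' 24 = clip (s 3) \<and>
      (\<forall>Y. Y \<notin> {8, 20, 22, 24} \<longrightarrow> s' Y = s Y))"
  unfolding load_root_def
proof (rule runs_Seq)
  have N: "s 0 0 = N" using s by (simp add: safe_def)
  let ?s = "s(20 := (s 20)(0 := N))"
  have "runs W (Write 20 (Const 0) (var 0)) s (cost (Write 20 (Const 0) (var 0))) (\<lambda>s'. s' = ?s)"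
    using N W_bounds by (intro runs_wp) simp
  then show "runs W (Write 20 (Const 0) (var 0)) s 4 (\<lambda>s'. s' = ?s)" by (rule runs_conseq) simp_all
  fix s' assume s': "s' = ?s"
  define I where "I k t \<longleftrightarrow> t 20 = (\<lambda>_. 0)(0 := N) \<and>
    t 22 = (\<lambda>a. if 0 \<le> a \<and> a < k then s 3 a else 0) \<and>
    t 24 = (\<lambda>a. if 0 \<le> a \<and> a < k then s 3 a else 0) \<and>
    (\<forall>Y. Y \<notin> {8, 20, 22, 24} \<longrightarrow> t Y = s Y)" for k and t :: memory
  show "runs W (for_loop 8 (Mul (var 0) (var 0)) copy_body) s' ((n * n + 1) * (cost copy_body + 15))
    (\<lambda>s'. s' 20 = (\<lambda>_. 0)(0 := N) \<and> s' 22 = clip (s 3) \<and> s' 24 = clip (s 3) \<and>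
      (\<forall>Y. Y \<notin> {8, 20, 22, 24} \<longrightarrow> s' Y = s Y))"
  proof (rule runs_square_loop[where I = I])
    show "I 0 (s'(8 := (s' 8)(0 := 0)))" using s by (auto simp: I_def s' safe_def)
  next
    fix k t assume I: "I k t"
    then show t0: "t 0 0 = N" by (simp add: I_def N)
    assume k: "0 \<le> k" "k < N * N" "t 8 0 = k"
    have t3: "t 3 = s 3" using I by (simp add: I_def)
    have "\<bar>s 3 a\<bar> \<le> W" for a using s W_bounds by (cases "s 3 a = 0") (auto simp: safe_def)
    moreover have "(if 0 \<le> a \<and> a < k then s 3 a else 0 :: int) = (if 0 \<le> a \<and> a < k + 1 then s 3 a else 0)"
      if "a \<noteq> k" for a using that by auto
    then have "(\<lambda>a. if 0 \<le> a \<and> a < k then s 3 a else 0)(k := s 3 k) =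
        (\<lambda>a. if 0 \<le> a \<and> a < k + 1 then s 3 a else 0)" using k by (auto simp: fun_eq_iff)
    ultimately show "wp W copy_body (\<lambda>s'. s' 8 0 = k \<and> I (k + 1) (s'(8 := (s' 8)(0 := k + 1)))) t"
      using k W_bounds I by (simp add: copy_body_def t3) (simp add: I_def)
  qed (simp add: I_def clip_def fun_eq_iff)
qed

lemma runs_load_support:
  assumes N: "s 0 0 = N" and zero: "s 15 = (\<lambda>_. 0)" "s 21 = (\<lambda>_. 0)" "s 23 = (\<lambda>_. 0)" "s 25 = (\<lambda>_. 0)"
    and bound: "\<And>a. 0 \<le> a \<Longrightarrow> a < N * N \<Longrightarrow> \<bar>s 26 a\<bar> \<le> W"
  shows "runs W load_support s (1 + 4 + (n * n + 1) * (cost support_body + 15))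
    (\<lambda>s'. s' 21 = (\<lambda>_. 0)(0 := N) \<and> s' 15 = clip (\<lambda>a. of_bool (0 < s 26 a)) \<and>
      s' 23 = clip (\<lambda>a. of_bool (0 < s 26 a)) \<and> s' 25 = clip (\<lambda>a. of_bool (0 < s 26 a)) \<and>
      (\<forall>Y. Y \<notin> {8, 15, 21, 23, 25} \<longrightarrow> s' Y = s Y))"
  unfolding load_support_def
proof (rule runs_Seq)
  let ?s = "s(21 := (s 21)(0 := N))"
  have "runs W (Write 21 (Const 0) (var 0)) s (cost (Write 21 (Const 0) (var 0))) (\<lambda>s'. s' = ?s)"
    using N W_bounds by (intro runs_wp) simp
  then show "runs W (Write 21 (Const 0) (var 0)) s 4 (\<lambda>s'. s' = ?s)" by (rule runs_conseq) simp_all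
  fix s' assume s': "s' = ?s"
  define m :: "int \<Rightarrow> int \<Rightarrow> int" where
    "m k = (\<lambda>a. if 0 \<le> a \<and> a < k \<and> 0 < s 26 a then 1 else 0)" for k
  define I where "I k t \<longleftrightarrow> t 21 = (\<lambda>_. 0)(0 := N) \<and> t 15 = m k \<and> t 23 = m k \<and> t 25 = m k \<and>
    (\<forall>Y. Y \<notin> {8, 15, 21, 23, 25} \<longrightarrow> t Y = s Y)" for k and t :: memory
  show "runs W (for_loop 8 (Mul (var 0) (var 0)) support_body) s' ((n * n + 1) * (cost support_body + 15))
    (\<lambda>s'. s' 21 = (\<lambda>_. 0)(0 := N) \<and> s' 15 = clip (\<lambda>a. of_bool (0 < s 26 a)) \<and>
      s' 23 = clip (\<lambda>a. of_bool (0 < s 26 a)) \<and> s' 25 = clip (\<lambda>a. of_bool (0 < s 26 a)) \<and>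
      (\<forall>Y. Y \<notin> {8, 15, 21, 23, 25} \<longrightarrow> s' Y = s Y))"
  proof (rule runs_square_loop[where I = I])
    show "I 0 (s'(8 := (s' 8)(0 := 0)))" using zero by (auto simp: I_def s' m_def)
  next
    fix k t assume I: "I k t"
    then show t0: "t 0 0 = N" by (simp add: I_def N)
    assume k: "0 \<le> k" "k < N * N" "t 8 0 = k"
    have t: "t 26 = s 26" using I by (simp add: I_def)
    have "a < k + 1 \<longleftrightarrow> a < k \<or> a = k" for a by auto
    then have m_step: "m (k + 1) = (if 0 < s 26 k then (m k)(k := 1) else m k)"
      using k by (auto simp: m_def fun_eq_iff)
    show "wp W support_body (\<lambda>s'. s' 8 0 = k \<and> I (k + 1) (s'(8 := (s' 8)(0 := k + 1)))) t"
      using k W_bounds I bound[OF k(1,2)] by (simp add: support_body_def t) (simp add: I_def m_step)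
  next
    have "m (N * N) = clip (\<lambda>a. of_bool (0 < s 26 a))" by (auto simp: m_def clip_def fun_eq_iff)
    then show "t 21 = (\<lambda>_. 0)(0 := N) \<and> t 15 = clip (\<lambda>a. of_bool (0 < s 26 a)) \<and>
      t 23 = clip (\<lambda>a. of_bool (0 < s 26 a)) \<and> t 25 = clip (\<lambda>a. of_bool (0 < s 26 a)) \<and>
      (\<forall>Y. Y \<notin> {8, 15, 21, 23, 25} \<longrightarrow> t Y = s Y)" if "I (N * N) t" for t
      using that by (simp add: I_def)
  qed
qed

text \<open>The meaning of a vanishing penalty. The second conjunct makes the two supports disjoint,
  so the sum in the third acts as a disjunction. The last conjunct depends on \<open>j\<close> alone
  and is simply tested again for each \<open>i\<close>.\<close>

definition passes :: "memory \<Rightarrow> int \<Rightarrow> int \<Rightarrow> bool" where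
  "passes s i j \<longleftrightarrow> s 3 (i * N + j) = s 3 (j * N + i) \<and> (s 3 (i * N + j) = 0 \<or> s 15 (i * N + j) = 0) \<and>
     (i \<noteq> j \<longrightarrow> g (i * N + j) = s 15 (i * N + j) + s 3 (i * N + j)) \<and>
     (s 27 (i * N + j) = 0 \<or> s 3 (i * N + j) = 0) \<and> s 3 (v * N + j) = U j"

text \<open>The five summands are nonnegative and at most 1, 1, \<open>4 * N * N\<close>,
  \<open>N\<close> and 1, so their sum vanishes only if each of them does. The third bound comes
  from \<open>\<bar>i - j\<bar> \<le> N\<close> and \<open>\<bar>e - b - a\<bar> \<le> 2\<close>.
  All intermediate values are listed because \<open>fits\<close> asks for each.\<close>

lemma penalty_bounds:
  fixes a a' b c e x y i j :: int
  assumes "a = 0 \<or> a = 1" "a' = 0 \<or> a' = 1" "b = 0 \<or> b = 1" "e = 0 \<or> e = 1"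
    "x = 0 \<or> x = 1" "y = 0 \<or> y = 1" and c: "0 \<le> c" "c \<le> N"
    and ij: "0 \<le> i" "i < N" "0 \<le> j" "j < N"
  shows "\<bar>a\<bar> \<le> W" "\<bar>a'\<bar> \<le> W" "\<bar>b\<bar> \<le> W" "\<bar>c\<bar> \<le> W" "\<bar>e\<bar> \<le> W" "\<bar>x\<bar> \<le> W" "\<bar>y\<bar> \<le> W"
    "\<bar>a - a'\<bar> \<le> W" "\<bar>(a - a') * (a - a')\<bar> \<le> W" "\<bar>a * b\<bar> \<le> W"
    "\<bar>(a - a') * (a - a') + a * b\<bar> \<le> W" "\<bar>i - j\<bar> \<le> W" "\<bar>e - b\<bar> \<le> W" "\<bar>e - b - a\<bar> \<le> W"
    "\<bar>(i - j) * (e - b - a)\<bar> \<le> W" "\<bar>((i - j) * (e - b - a)) * ((i - j) * (e - b - a))\<bar> \<le> W"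
    "\<bar>(a - a') * (a - a') + a * b + ((i - j) * (e - b - a)) * ((i - j) * (e - b - a))\<bar> \<le> W"
    "\<bar>c * a\<bar> \<le> W"
    "\<bar>(a - a') * (a - a') + a * b + ((i - j) * (e - b - a)) * ((i - j) * (e - b - a)) + c * a\<bar> \<le> W"
    "\<bar>x - y\<bar> \<le> W" "\<bar>(x - y) * (x - y)\<bar> \<le> W"
    "\<bar>(a - a') * (a - a') + a * b + ((i - j) * (e - b - a)) * ((i - j) * (e - b - a)) + c * a + (x - y) * (x - y)\<bar> \<le> W"
    "0 < (a - a') * (a - a') + a * b + ((i - j) * (e - b - a)) * ((i - j) * (e - b - a)) + c * a + (x - y) * (x - y)
      \<longleftrightarrow> \<not> (a = a' \<and> (a = 0 \<or> b = 0) \<and> (i \<noteq> j \<longrightarrow> e = b + a) \<and> (c = 0 \<or> a = 0) \<and> x = y)"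
proof -
  \<comment> \<open>Named summands hide the products, so that the bounds on partial sums become
    linear arithmetic.\<close>
  define d1 d2 d3 d4 d5 where "d1 = (a - a') * (a - a')" and "d2 = a * b"
    and "d3 = ((i - j) * (e - b - a)) * ((i - j) * (e - b - a))" and "d4 = c * a" and "d5 = (x - y) * (x - y)"
  have 1: "0 \<le> d1" "d1 \<le> 1" "d1 = 0 \<longleftrightarrow> a = a'" using assms by (auto simp: d1_def)
  have 2: "0 \<le> d2" "d2 \<le> 1" "d2 = 0 \<longleftrightarrow> a = 0 \<or> b = 0" using assms by (auto simp: d2_def)
  have "\<bar>i - j\<bar> * \<bar>e - b - a\<bar> \<le> N * 2" using assms by (intro mult_mono) auto
  then have lin: "\<bar>(i - j) * (e - b - a)\<bar> \<le> 2 * N" by (simp add: abs_mult)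
  then have "\<bar>(i - j) * (e - b - a)\<bar> * \<bar>(i - j) * (e - b - a)\<bar> \<le> (2 * N) * (2 * N)"
    by (intro mult_mono) auto
  then have 3: "0 \<le> d3" "d3 \<le> 4 * (N * N)" "d3 = 0 \<longleftrightarrow> i = j \<or> e = b + a"
    by (auto simp: d3_def abs_mult_self_eq)
  have 4: "0 \<le> d4" "d4 \<le> N" "d4 = 0 \<longleftrightarrow> c = 0 \<or> a = 0" using assms by (auto simp: d4_def)
  have 5: "0 \<le> d5" "d5 \<le> 1" "d5 = 0 \<longleftrightarrow> x = y" using assms by (auto simp: d5_def)
  show "\<bar>a\<bar> \<le> W" "\<bar>a'\<bar> \<le> W" "\<bar>b\<bar> \<le> W" "\<bar>c\<bar> \<le> W" "\<bar>e\<bar> \<le> W" "\<bar>x\<bar> \<le> W" "\<bar>y\<bar> \<le> W"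
    "\<bar>a - a'\<bar> \<le> W" "\<bar>i - j\<bar> \<le> W" "\<bar>e - b\<bar> \<le> W" "\<bar>x - y\<bar> \<le> W"
    using assms W_bounds by arith+
  have "0 \<le> N * N" by simp
  note W' = this W
  show "\<bar>e - b - a\<bar> \<le> W" using assms W' by linarith
  show "\<bar>(i - j) * (e - b - a)\<bar> \<le> W" using lin W' by linarith
  show "\<bar>(a - a') * (a - a')\<bar> \<le> W" using 1 W' unfolding d1_def[symmetric] by linarith
  show "\<bar>a * b\<bar> \<le> W" using 2 W' unfolding d2_def[symmetric] by linarith
  show "\<bar>((i - j) * (e - b - a)) * ((i - j) * (e - b - a))\<bar> \<le> W"
    using 3 W' unfolding d3_def[symmetric] by linarith
  show "\<bar>c * a\<bar> \<le> W" using 4 W' unfolding d4_def[symmetric] by linarith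
  show "\<bar>(x - y) * (x - y)\<bar> \<le> W" using 5 W' unfolding d5_def[symmetric] by linarith
  show "\<bar>(a - a') * (a - a') + a * b\<bar> \<le> W"
    "\<bar>(a - a') * (a - a') + a * b + ((i - j) * (e - b - a)) * ((i - j) * (e - b - a))\<bar> \<le> W"
    "\<bar>(a - a') * (a - a') + a * b + ((i - j) * (e - b - a)) * ((i - j) * (e - b - a)) + c * a\<bar> \<le> W"
    "\<bar>(a - a') * (a - a') + a * b + ((i - j) * (e - b - a)) * ((i - j) * (e - b - a)) + c * a + (x - y) * (x - y)\<bar> \<le> W"
    unfolding d1_def[symmetric] d2_def[symmetric] d3_def[symmetric] d4_def[symmetric] d5_def[symmetric]
    using 1 2 3 4 5 W' by linarith+
  show "0 < (a - a') * (a - a') + a * b + ((i - j) * (e - b - a)) * ((i - j) * (e - b - a)) + c * a + (x - y) * (x - y)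
      \<longleftrightarrow> \<not> (a = a' \<and> (a = 0 \<or> b = 0) \<and> (i \<noteq> j \<longrightarrow> e = b + a) \<and> (c = 0 \<or> a = 0) \<and> x = y)"
  proof -
    have "d1 = 0 \<and> d2 = 0 \<and> d3 = 0 \<and> d4 = 0 \<and> d5 = 0" if "\<not> 0 < d1 + d2 + d3 + d4 + d5"
      using that 1(1) 2(1) 3(1) 4(1) 5(1) by (intro conjI; linarith)
    then have "0 < d1 + d2 + d3 + d4 + d5 \<longleftrightarrow> \<not> (d1 = 0 \<and> d2 = 0 \<and> d3 = 0 \<and> d4 = 0 \<and> d5 = 0)"
      by auto
    then show ?thesis
      unfolding 1(3) 2(3) 3(3) 4(3) 5(3) d1_def[symmetric] d2_def[symmetric] d3_def[symmetric]
        d4_def[symmetric] d5_def[symmetric]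
      by blast
  qed
qed

lemma runs_check:
  assumes s: "s 0 0 = N" "s 0 1 = v" "s 1 = g" "s 2 = U"
    and "\<And>a. s 3 a = 0 \<or> s 3 a = 1" and "\<And>a. s 15 a = 0 \<or> s 15 a = 1"
    and "\<And>a. 0 \<le> a \<Longrightarrow> a < N * N \<Longrightarrow> 0 \<le> s 27 a \<and> s 27 a \<le> N"
  shows "runs W check s (1 + 3 + (n * n + 1) * (cost check_body + 15))
    (\<lambda>s'. s' 3 = s 3 \<and> s' 4 0 = of_bool (\<forall>i<n. \<forall>j<n. passes s (int i) (int j)))"
  unfolding check_def
proof (rule runs_Seq)
  let ?s = "s(4 := (s 4)(0 := 1))"
  have "runs W (Write 4 (Const 0) (Const 1)) s (cost (Write 4 (Const 0) (Const 1))) (\<lambda>s'. s' = ?s)"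
    using W_bounds by (intro runs_wp) simp
  then show "runs W (Write 4 (Const 0) (Const 1)) s 3 (\<lambda>s'. s' = ?s)" by (rule runs_conseq) simp_all
  fix s' assume s': "s' = ?s"
  define good where "good a \<longleftrightarrow> passes s (a div N) (a - a div N * N)" for a
  define I where "I k t \<longleftrightarrow> (\<forall>Y. Y \<notin> {4, 8, 11, 12} \<longrightarrow> t Y = s Y) \<and>
    t 4 0 = of_bool (\<forall>a. 0 \<le> a \<longrightarrow> a < k \<longrightarrow> good a)" for k and t :: memory
  show "runs W (for_loop 8 (Mul (var 0) (var 0)) check_body) s' ((n * n + 1) * (cost check_body + 15))
    (\<lambda>s'. s' 3 = s 3 \<and> s' 4 0 = of_bool (\<forall>i<n. \<forall>j<n. passes s (int i) (int j)))"
  proof (rule runs_square_loop[where I = I])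
    show "I 0 (s'(8 := (s' 8)(0 := 0)))" by (auto simp: I_def s')
  next
    fix k t assume I: "I k t"
    then show t0: "t 0 0 = N" by (simp add: I_def s)
    assume k: "0 \<le> k" "k < N * N" "t 8 0 = k"
    define i j where "i = k div N" and "j = k - i * N"
    have j_mod: "j = k mod N" by (simp add: j_def i_def minus_div_mult_eq_mod)
    have ij: "0 \<le> i" "i < N" "0 \<le> j" "j < N"
      using div_mod_bounds[OF k(1,2)] unfolding j_mod i_def by simp_all
    have k_eq: "i * N + j = k" by (simp add: j_def)
    have t: "t 0 1 = v" "t (Suc 0) = g" "t 2 = U" "t 3 = s 3" "t 15 = s 15" "t 27 = s 27"
      using I s by (simp_all add: I_def)
    have c: "0 \<le> s 27 k" "s 27 k \<le> N" using assms(7) k by auto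
    note pb = penalty_bounds[OF assms(5)[of k] assms(5)[of "j * N + i"] assms(6)[of k] g01[of k]
      assms(5)[of "v * N + j"] U01[of j] c ij]
    have good: "good k \<longleftrightarrow> (s 3 k = s 3 (j * N + i) \<and> (s 3 k = 0 \<or> s 15 k = 0) \<and> (i \<noteq> j \<longrightarrow> g k = s 15 k + s 3 k) \<and>
        (s 27 k = 0 \<or> s 3 k = 0) \<and> s 3 (v * N + j) = U j)"
      unfolding good_def passes_def i_def[symmetric] j_def[symmetric] k_eq by blast
    have step: "(\<forall>a. 0 \<le> a \<longrightarrow> a < k + 1 \<longrightarrow> good a) \<longleftrightarrow> (\<forall>a. 0 \<le> a \<longrightarrow> a < k \<longrightarrow> good a) \<and> good k"
      using k(1) by (auto simp: zless_add1_eq)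
    let ?t = "t(11 := (t 11)(0 := i), 12 := (t 12)(0 := j))"
    have bounds: "\<bar>i\<bar> \<le> W" "\<bar>j\<bar> \<le> W" "\<bar>k\<bar> \<le> W" "\<bar>N\<bar> \<le> W" "\<bar>v\<bar> \<le> W" "\<bar>i * N\<bar> \<le> W" "\<bar>j * N\<bar> \<le> W" "\<bar>v * N\<bar> \<le> W"
      "\<bar>j * N + i\<bar> \<le> W" "\<bar>v * N + j\<bar> \<le> W" "1 \<le> W" "0 \<le> W"
      using ij v k W_bounds addr_bounds[OF ij] addr_bounds[OF ij(3,4,1,2)] addr_bounds[OF v ij(3,4)]
      by linarith+
    have penalty: "fits W ?t penalty" "0 < eval_expr ?t penalty \<longleftrightarrow> \<not> good k"
      unfolding good pb(23)[symmetric]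
      using pb(1-22) bounds by (simp_all add: penalty_def t t0 k(3))
    have "I (k + 1) (?t(4 := (t 4)(0 := 0), 8 := (t 8)(0 := k + 1)))" if "\<not> good k"
      using I that k(1) by (auto simp: I_def)
    moreover have "I (k + 1) (?t(8 := (t 8)(0 := k + 1)))" if "good k"
      using I that unfolding I_def step by simp
    ultimately show "wp W check_body (\<lambda>s'. s' 8 0 = k \<and> I (k + 1) (s'(8 := (s' 8)(0 := k + 1)))) t"
      using bounds k penalty by (simp add: check_body_def t0 i_def[symmetric] j_def[symmetric])
  next
    fix t assume I: "I (N * N) t"
    have "(\<forall>a. 0 \<le> a \<longrightarrow> a < N * N \<longrightarrow> good a) \<longleftrightarrow> (\<forall>i<n. \<forall>j<n. passes s (int i) (int j))"
    proof
      assume a: "\<forall>a. 0 \<le> a \<longrightarrow> a < N * N \<longrightarrow> good a"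
      show "\<forall>i<n. \<forall>j<n. passes s (int i) (int j)"
      proof (intro allI impI)
        fix i j assume ij: "i < n" "j < n"
        then have "good (int i * N + int j)" using a addr_bounds[of "int i" "int j"] by simp
        moreover have "(int i * N + int j) div N = int i" using ij by simp
        ultimately show "passes s (int i) (int j)" by (simp add: good_def)
      qed
    next
      assume p: "\<forall>i<n. \<forall>j<n. passes s (int i) (int j)"
      show "\<forall>a. 0 \<le> a \<longrightarrow> a < N * N \<longrightarrow> good a"
      proof (intro allI impI)
        fix a assume a: "0 \<le> a" "a < N * N"
        show "good a"
          using div_mod_bounds[OF a] p[rule_format, of "nat (a div N)" "nat (a mod N)"]
          by (simp add: good_def minus_div_mult_eq_mod nat_less_iff)
      qed
    qed
    with I show "t 3 = s 3 \<and> t 4 0 = of_bool (\<forall>i<n. \<forall>j<n. passes s (int i) (int j))"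
      by (simp add: I_def)
  qed
qed

end

section \<open>Quadratic lower bound for matrix multiplication\<close>

lemma square_le_multiplication_time:
  assumes "multiplies_matrices d P M"
  shows "n * n \<le> M n"
proof (cases "n = 0")
  case False
  define A :: "int mat" where "A = mat n n (\<lambda>_. 1)"
  have A: "A \<in> carrier_mat n n" by (simp add: A_def)
  have "1 \<le> int n ^ d" using False by (intro one_le_power) simp
  then have "\<forall>i<n. \<forall>j<n. \<bar>A $$ (i, j)\<bar> \<le> int n ^ d \<and> \<bar>A $$ (i, j)\<bar> \<le> int n ^ d"
    by (simp add: A_def)
  with assms A obtain k t s where exec: "exec (word_bound k n) P (mult_input n A A) t s"
    and "t \<le> M n" and holds: "bank_holds n (A * A) (s 3)"
    unfolding multiplies_matrices_def by meson
  let ?C = "{(X, a). mult_input n A A X a \<noteq> s X a}"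
  \<comment> \<open>Bank 3 holds no input and starts at zero, whereas every entry of the product is
    \<open>n\<close>, hence nonzero.\<close>
  have sub: "(\<lambda>a. (3 :: nat, int a)) ` {..<n * n} \<subseteq> ?C"
  proof (intro subsetI, elim imageE)
    fix y a assume y: "y = (3 :: nat, int a)" and "a \<in> {..<n * n}"
    then have a: "a div n < n" "a mod n < n" using False by (auto simp: less_mult_imp_div_less)
    have "s 3 (int (a div n * n + a mod n)) = (A * A) $$ (a div n, a mod n)"
      using holds a unfolding bank_holds_def by blast
    also have "\<dots> = int n" using a by (simp add: A_def scalar_prod_def)
    finally have "s 3 (int a) = int n" by simp
    then show "y \<in> ?C" using False by (simp add: y mult_input_def)
  qed
  have "n * n = card ((\<lambda>a. (3 :: nat, int a)) ` {..<n * n})"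
    by (subst card_image) (auto simp: inj_on_def)
  also have "\<dots> \<le> card ?C"
    using exec_card_changed[OF exec] sub by (intro card_mono) auto
  also have "\<dots> \<le> t" using exec_card_changed[OF exec] by blast
  also have "\<dots> \<le> M n" by fact
  finally show ?thesis .
qed simp

section \<open>Roots as a condition on the adjacency relation\<close>

text \<open>The content of \<open>passes\<close> over all entries, freed from memory, so that
  program and graph theory meet in one formula. A walk of length 4 is split at its midpoint
  \<open>l\<close> because it is read off from the square of the support.\<close>

definition root_test :: "nat \<Rightarrow> (nat \<Rightarrow> nat \<Rightarrow> bool) \<Rightarrow> nat \<Rightarrow> (nat \<Rightarrow> bool) \<Rightarrow> (nat \<Rightarrow> nat \<Rightarrow> bool) \<Rightarrow> bool" where
  "root_test n G v U E \<longleftrightarrow> (\<forall>i<n. \<forall>j<n. (E i j \<longleftrightarrow> E j i) \<and> (E i j \<longrightarrow> \<not> (\<exists>k<n. E i k \<and> E k j)) \<and>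
     (i \<noteq> j \<longrightarrow> (G i j \<longleftrightarrow> E i j \<or> (\<exists>k<n. E i k \<and> E k j))) \<and>
     (E i j \<longrightarrow> \<not> (\<exists>l<n. (\<exists>k<n. E i k \<and> E k l) \<and> (\<exists>k<n. E l k \<and> E k j))) \<and> (E v j \<longleftrightarrow> U j))"

lemma root_testD:
  assumes "root_test n G v U E" "i < n" "j < n"
  shows "E i j \<longleftrightarrow> E j i" "E i j \<Longrightarrow> k < n \<Longrightarrow> E i k \<Longrightarrow> E k j \<Longrightarrow> False"
    "i \<noteq> j \<Longrightarrow> G i j \<longleftrightarrow> E i j \<or> (\<exists>k<n. E i k \<and> E k j)"
    "E i j \<Longrightarrow> l < n \<Longrightarrow> k < n \<Longrightarrow> k' < n \<Longrightarrow> E i k \<Longrightarrow> E k l \<Longrightarrow> E l k' \<Longrightarrow> E k' j \<Longrightarrow> False"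
    "E v j \<longleftrightarrow> U j"
proof -
  note * = assms(1)[unfolded root_test_def, THEN spec, THEN mp, OF assms(2), THEN spec, THEN mp, OF assms(3)]
  show "E i j \<longleftrightarrow> E j i" "i \<noteq> j \<Longrightarrow> G i j \<longleftrightarrow> E i j \<or> (\<exists>k<n. E i k \<and> E k j)" "E v j \<longleftrightarrow> U j"
    using * by simp_all
  show "E i j \<Longrightarrow> k < n \<Longrightarrow> E i k \<Longrightarrow> E k j \<Longrightarrow> False"
    "E i j \<Longrightarrow> l < n \<Longrightarrow> k < n \<Longrightarrow> k' < n \<Longrightarrow> E i k \<Longrightarrow> E k l \<Longrightarrow> E l k' \<Longrightarrow> E k' j \<Longrightarrow> False"
    using * by blast+
qed

text \<open>The relation \<open>E\<close> is arbitrary, so the verdict is also right for a matrix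
  that a search without a root has left behind.\<close>

lemma root_iff_test:
  assumes G: "pair_graph G" "pverts G = {..<n}" and v: "v < n" and U: "U \<subseteq> {..<n}"
    and H: "H = \<lparr>pverts = {..<n}, parcs = {(i, j). i < n \<and> j < n \<and> E i j}\<rparr>"
  shows "C3_C5_free_root_at G v U H \<longleftrightarrow> root_test n (\<lambda>i j. (i, j) \<in> parcs G) v (\<lambda>j. j \<in> U) E"
proof
  have arcs: "(i, j) \<in> parcs H \<longleftrightarrow> i < n \<and> j < n \<and> E i j" for i j by (simp add: H)
  {
    assume root: "C3_C5_free_root_at G v U H"
    then have h: "pair_graph H" "\<not> has_cycle_of_length H 3" "\<not> has_cycle_of_length H 5"
      "graph_square H = G" "neighbourhood H v = U" by (auto simp: C3_C5_free_root_at_def)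
    note sq = graph_square_arcs[OF h(1), unfolded h(4) arcs]
    have sym: "E j i" if "i < n" "j < n" "E i j" for i j
      using pair_graph_symD[OF h(1), of i j] that by (simp add: arcs)
    have 3: False if "i < n" "j < n" "k < n" "E i k" "E k j" "E j i" for i j k
      using h(2) that unfolding has_cycle_3[OF h(1)] arcs by blast
    have 5: False if "i < n" "j < n" "k < n" "l < n" "m < n" "E i k" "E k l" "E l m" "E m j" "E j i" for i j k l m
      using h(3) that unfolding has_cycle_5[OF h(1,2)] arcs by blast
    show "root_test n (\<lambda>i j. (i, j) \<in> parcs G) v (\<lambda>j. j \<in> U) E"
      unfolding root_test_def
    proof (intro allI impI conjI notI)
      fix i j assume ij: "i < n" "j < n"
      show "E i j \<longleftrightarrow> E j i" using sym ij by blast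
      show False if "E i j" "\<exists>k<n. E i k \<and> E k j" using that sym[OF ij] 3 ij by blast
      show "(i, j) \<in> parcs G \<longleftrightarrow> E i j \<or> (\<exists>k<n. E i k \<and> E k j)" if "i \<noteq> j"
        using that ij by (auto simp: sq)
      show False if "E i j" "\<exists>l<n. (\<exists>k<n. E i k \<and> E k l) \<and> (\<exists>k<n. E l k \<and> E k j)"
        using that sym[OF ij] 5 ij by blast
      show "E v j \<longleftrightarrow> j \<in> U" using ij v by (auto simp: arcs neighbourhood_def simp flip: h(5))
    qed
  }
  assume test: "root_test n (\<lambda>i j. (i, j) \<in> parcs G) v (\<lambda>j. j \<in> U) E"
  note D = root_testD[OF test]
  \<comment> \<open>A loop, traversed three times, is a closed walk of length 3, so the triangle
    condition excludes loops as well.\<close>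
  have irr: "\<not> E i i" if "i < n" for i using D(2)[of i i i] that by blast
  have fin: "finite (parcs H)" by (rule finite_subset[of _ "{..<n} \<times> {..<n}"]) (auto simp: H)
  have h: "pair_graph H"
  proof unfold_locales
    show "symmetric H" unfolding symmetric_def by (rule symI) (use D(1) in \<open>auto simp: arcs\<close>)
    show "fst e \<noteq> snd e" if "e \<in> parcs H" for e
      using that irr by (cases e) (auto simp: arcs)
  qed (use fin in \<open>auto simp: H\<close>)
  have c3: "\<not> has_cycle_of_length H 3"
    unfolding has_cycle_3[OF h] arcs using D(1,2) by blast
  have c5: "\<not> has_cycle_of_length H 5"
    unfolding has_cycle_5[OF h c3] arcs using D(1,4) by blast
  have "(i, j) \<in> parcs (graph_square H) \<longleftrightarrow> (i, j) \<in> parcs G" for i j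
  proof (cases "i < n \<and> j < n \<and> i \<noteq> j")
    case True
    then show ?thesis using D(3)[of i j] unfolding graph_square_arcs[OF h] arcs by blast
  next
    case False
    then have "(i, j) \<notin> parcs G"
      using pair_graph_wfD[OF G(1), of i j] pair_graph_irreflD[OF G(1)] G(2) by auto
    then show ?thesis using False unfolding graph_square_arcs[OF h] arcs by blast
  qed
  then have "parcs (graph_square H) = parcs G" by auto
  moreover have "pverts (graph_square H) = pverts G" by (simp add: H G(2))
  ultimately have "graph_square H = G" by simp
  moreover have "neighbourhood H v = U"
    using U v D(5)[OF v] by (auto simp: neighbourhood_def arcs)
  ultimately show "C3_C5_free_root_at G v U H"
    using h c3 c5 by (simp add: C3_C5_free_root_at_def)
qed

section \<open>The complete program\<close>

definition root_prog :: "prog \<Rightarrow> prog" where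
  "root_prog P = Seq search (Seq load_root (Seq (rename_prog bank\<^sub>1 P)
     (Seq load_support (Seq (rename_prog bank\<^sub>2 P) check))))"

definition root_time :: "nat \<Rightarrow> nat \<Rightarrow> nat" where
  "root_time n M = 1 + search_time n +
     (1 + (1 + 4 + (n * n + 1) * (cost copy_body + 15)) + (1 + M +
     (1 + (1 + 4 + (n * n + 1) * (cost support_body + 15)) + (1 + M +
     (1 + 3 + (n * n + 1) * (cost check_body + 15))))))"

context search_instance
begin

lemma index_cases:
  assumes "0 \<le> a" "a < N * N"
  obtains i j where "i < n" "j < n" "a = int i * N + int j"
proof
  note b = div_mod_bounds[OF assms]
  show "nat (a div N) < n" "nat (a mod N) < n" using b by (simp_all add: nat_less_iff)
  show "a = int (nat (a div N)) * N + int (nat (a mod N))" using b by simp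
qed

text \<open>Bank 3 is described relative to every candidate, whereas the verdict speaks of the
  actual contents of bank 3 and thus makes sense without a candidate.\<close>

lemma runs_root_prog:
  assumes P: "\<And>A B. A \<in> carrier_mat n n \<Longrightarrow> B \<in> carrier_mat n n \<Longrightarrow>
      \<forall>i<n. \<forall>j<n. \<bar>A $$ (i, j)\<bar> \<le> int n ^ d \<and> \<bar>B $$ (i, j)\<bar> \<le> int n ^ d \<Longrightarrow>
      \<exists>t s. exec W' P (mult_input n A B) t s \<and> t \<le> M \<and> bank_holds n (A * B) (s 3)"
    and W': "W' \<le> W"
    and s: "safe s" "\<And>a. s 5 a = 0" "\<And>a. s 6 a = 0"
  shows "runs W (root_prog P) s (root_time n M)
    (\<lambda>s'. (\<forall>R. candidate R \<longrightarrow> (\<forall>i<n. \<forall>j<n. s' 3 (int i * N + int j) = of_bool (R (int i) (int j)))) \<and>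
       (\<forall>a. s' 3 a = 0 \<or> s' 3 a = 1) \<and>
       s' 4 0 = of_bool (root_test n (\<lambda>i j. g (int i * N + int j) = 1) (nat v) (\<lambda>j. U (int j) = 1)
         (\<lambda>i j. s' 3 (int i * N + int j) = 1)))"
  unfolding root_prog_def root_time_def
proof (rule runs_Seq[OF runs_search[OF s]])
  fix s\<^sub>1 assume "safe s\<^sub>1 \<and> (\<forall>R. candidate R \<longrightarrow> (\<forall>u. 0 \<le> u \<longrightarrow> u < N \<longrightarrow> row_ok R s\<^sub>1 u))"
  then have s\<^sub>1: "safe s\<^sub>1" and rows: "\<And>R u. candidate R \<Longrightarrow> 0 \<le> u \<Longrightarrow> u < N \<Longrightarrow> row_ok R s\<^sub>1 u" by auto
  have \<alpha>: "s\<^sub>1 3 a = 0 \<or> s\<^sub>1 3 a = 1" for a using s\<^sub>1 by (simp add: safe_def)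
  define E where "E i j \<longleftrightarrow> s\<^sub>1 3 (int i * N + int j) = 1" for i j
  define A where "A = mat n n (\<lambda>(i, j). s\<^sub>1 3 (int i * N + int j))"
  have A: "A \<in> carrier_mat n n" by (simp add: A_def)
  have A01: "A $$ (i, j) = 0 \<or> A $$ (i, j) = 1" if "i < n" "j < n" for i j
    using that \<alpha> by (simp add: A_def)
  have AE: "A $$ (i, j) = 1 \<longleftrightarrow> E i j" if "i < n" "j < n" for i j
    using that by (simp add: A_def E_def)
  have bankA: "matrix_bank n A = clip (s\<^sub>1 3)"
    by (simp add: fun_eq_iff A_def matrix_bank_mat clip_def)
  define B where "B = mat n n (\<lambda>(i, j). of_bool (0 < (A * A) $$ (i, j)) :: int)"
  have B: "B \<in> carrier_mat n n" by (simp add: B_def)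
  have B01: "B $$ (i, j) = 0 \<or> B $$ (i, j) = 1" if "i < n" "j < n" for i j
    using that by (simp add: B_def)
  have BE: "B $$ (i, j) = of_bool (\<exists>k<n. E i k \<and> E k j)" if "i < n" "j < n" for i j
    using that AE mat01_square(3)[OF A A01 that] by (auto simp: B_def)
  show "runs W (Seq load_root (Seq (rename_prog bank\<^sub>1 P) (Seq load_support (Seq (rename_prog bank\<^sub>2 P) check)))) s\<^sub>1
      (1 + (1 + 4 + (n * n + 1) * (cost copy_body + 15)) + (1 + M +
       (1 + (1 + 4 + (n * n + 1) * (cost support_body + 15)) + (1 + M +
       (1 + 3 + (n * n + 1) * (cost check_body + 15))))))
    (\<lambda>s'. (\<forall>R. candidate R \<longrightarrow> (\<forall>i<n. \<forall>j<n. s' 3 (int i * N + int j) = of_bool (R (int i) (int j)))) \<and>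
       (\<forall>a. s' 3 a = 0 \<or> s' 3 a = 1) \<and>
       s' 4 0 = of_bool (root_test n (\<lambda>i j. g (int i * N + int j) = 1) (nat v) (\<lambda>j. U (int j) = 1)
         (\<lambda>i j. s' 3 (int i * N + int j) = 1)))" (is "runs _ _ _ _ ?Q")
  proof (rule runs_Seq[OF runs_load_root[OF s\<^sub>1]])
    fix s\<^sub>2 assume s\<^sub>2: "s\<^sub>2 20 = (\<lambda>_. 0)(0 := N) \<and> s\<^sub>2 22 = clip (s\<^sub>1 3) \<and> s\<^sub>2 24 = clip (s\<^sub>1 3) \<and>
      (\<forall>Y. Y \<notin> {8, 20, 22, 24} \<longrightarrow> s\<^sub>2 Y = s\<^sub>1 Y)"
    \<comment> \<open>The even banks from 26 upwards have not been written yet and supply the zeros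
      that \<open>mult_input\<close> demands.\<close>
    have in1: "(\<lambda>X. s\<^sub>2 (bank\<^sub>1 X)) = mult_input n A A"
      using s\<^sub>1 s\<^sub>2 by (auto simp: fun_eq_iff mult_input_def bankA safe_def)
    have inj1: "inj bank\<^sub>1" by (simp add: inj_def)
    show "runs W (Seq (rename_prog bank\<^sub>1 P) (Seq load_support (Seq (rename_prog bank\<^sub>2 P) check))) s\<^sub>2
      (1 + M + (1 + (1 + 4 + (n * n + 1) * (cost support_body + 15)) + (1 + M +
       (1 + 3 + (n * n + 1) * (cost check_body + 15))))) ?Q"
    proof (rule runs_Seq[OF runs_multiply[OF P W' inj1 A A01 in1]])
      fix s\<^sub>3 assume "bank_holds n (A * A) (s\<^sub>3 (bank\<^sub>1 3)) \<and> (\<forall>Y. Y \<notin> range bank\<^sub>1 \<longrightarrow> s\<^sub>3 Y = s\<^sub>2 Y)"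
      then have AA: "\<And>i j. i < n \<Longrightarrow> j < n \<Longrightarrow> s\<^sub>3 26 (int i * N + int j) = (A * A) $$ (i, j)"
        and frame3: "\<And>Y. Y < 20 \<or> odd Y \<Longrightarrow> s\<^sub>3 Y = s\<^sub>2 Y"
        using not_in_range_bank\<^sub>1 by (auto simp: bank_holds_def)
      have AA_bound: "\<bar>s\<^sub>3 26 a\<bar> \<le> W" if a: "0 \<le> a" "a < N * N" for a
      proof -
        obtain i j where ij: "i < n" "j < n" "a = int i * N + int j" using index_cases[OF a] .
        then show ?thesis using AA mat01_square(1,2)[OF A A01 ij(1,2)] W_bounds by simp
      qed
      have clipB: "matrix_bank n B = clip (\<lambda>a. of_bool (0 < s\<^sub>3 26 a))"
      proof -
        have "B = mat n n (\<lambda>(i, j). of_bool (0 < s\<^sub>3 26 (int i * N + int j)))"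
          unfolding B_def by (rule eq_matI) (auto simp: AA)
        then have "matrix_bank n B a = (if 0 \<le> a \<and> a < N * N then of_bool (0 < s\<^sub>3 26 a) else 0)" for a
          using matrix_bank_mat[of n "\<lambda>a. of_bool (0 < s\<^sub>3 26 a)" a] by simp
        then show ?thesis unfolding fun_eq_iff clip_def by blast
      qed
      have zero: "s\<^sub>3 0 0 = N" "s\<^sub>3 15 = (\<lambda>_. 0)" "s\<^sub>3 21 = (\<lambda>_. 0)" "s\<^sub>3 23 = (\<lambda>_. 0)" "s\<^sub>3 25 = (\<lambda>_. 0)"
        using s\<^sub>1 s\<^sub>2 by (simp_all add: frame3 safe_def)
      show "runs W (Seq load_support (Seq (rename_prog bank\<^sub>2 P) check)) s\<^sub>3
        (1 + (1 + 4 + (n * n + 1) * (cost support_body + 15)) + (1 + M +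
         (1 + 3 + (n * n + 1) * (cost check_body + 15)))) ?Q"
      proof (rule runs_Seq[OF runs_load_support[OF zero AA_bound]])
        fix s\<^sub>4 assume "s\<^sub>4 21 = (\<lambda>_. 0)(0 := N) \<and> s\<^sub>4 15 = clip (\<lambda>a. of_bool (0 < s\<^sub>3 26 a)) \<and>
          s\<^sub>4 23 = clip (\<lambda>a. of_bool (0 < s\<^sub>3 26 a)) \<and> s\<^sub>4 25 = clip (\<lambda>a. of_bool (0 < s\<^sub>3 26 a)) \<and>
          (\<forall>Y. Y \<notin> {8, 15, 21, 23, 25} \<longrightarrow> s\<^sub>4 Y = s\<^sub>3 Y)"
        then have s\<^sub>4: "s\<^sub>4 21 = (\<lambda>_. 0)(0 := N)" "s\<^sub>4 15 = matrix_bank n B" "s\<^sub>4 23 = matrix_bank n B"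
            "s\<^sub>4 25 = matrix_bank n B" "\<And>Y. Y \<notin> {8, 15, 21, 23, 25} \<Longrightarrow> s\<^sub>4 Y = s\<^sub>3 Y"
          by (auto simp: clipB)
        \<comment> \<open>The first multiplication wrote to even banks only, so the odd banks from
          27 upwards are still zero.\<close>
        have rest: "s\<^sub>4 (bank\<^sub>2 X) = (\<lambda>_. 0)" if "3 \<le> X" for X
          using that s\<^sub>1 s\<^sub>2 s\<^sub>4(5)[of "bank\<^sub>2 X"] by (simp add: frame3 safe_def)
        have in2: "(\<lambda>X. s\<^sub>4 (bank\<^sub>2 X)) = mult_input n B B"
        proof
          fix X :: nat
          consider "X = 0" | "X = 1" | "X = 2" | "3 \<le> X" by linarith
          then show "s\<^sub>4 (bank\<^sub>2 X) = mult_input n B B X"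
            by cases (use rest[of X] in \<open>simp_all add: mult_input_def s\<^sub>4\<close>)
        qed
        have inj2: "inj bank\<^sub>2" by (simp add: inj_def)
        show "runs W (Seq (rename_prog bank\<^sub>2 P) check) s\<^sub>4
          (1 + M + (1 + 3 + (n * n + 1) * (cost check_body + 15))) ?Q"
        proof (rule runs_Seq[OF runs_multiply[OF P W' inj2 B B01 in2]])
          fix s\<^sub>5 assume "bank_holds n (B * B) (s\<^sub>5 (bank\<^sub>2 3)) \<and> (\<forall>Y. Y \<notin> range bank\<^sub>2 \<longrightarrow> s\<^sub>5 Y = s\<^sub>4 Y)"
          then have BB: "\<And>i j. i < n \<Longrightarrow> j < n \<Longrightarrow> s\<^sub>5 27 (int i * N + int j) = (B * B) $$ (i, j)"
            and frame5: "\<And>Y. Y < 21 \<or> even Y \<Longrightarrow> s\<^sub>5 Y = s\<^sub>4 Y"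
            using not_in_range_bank\<^sub>2 by (auto simp: bank_holds_def)
          have low: "s\<^sub>5 Y = s\<^sub>1 Y" if "Y < 5" for Y
            using that s\<^sub>2 s\<^sub>4(5)[of Y] by (auto simp: frame3 frame5)
          have s\<^sub>5: "s\<^sub>5 0 0 = N" "s\<^sub>5 0 1 = v" "s\<^sub>5 1 = g" "s\<^sub>5 2 = U" "s\<^sub>5 3 = s\<^sub>1 3"
            "s\<^sub>5 15 = matrix_bank n B"
            using s\<^sub>1 by (simp_all add: low frame5 s\<^sub>4 safe_def)
          have \<beta>: "s\<^sub>5 15 (int i * N + int j) = of_bool (\<exists>k<n. E i k \<and> E k j)" if ij: "i < n" "j < n" for i j
            using ij addr_bounds[of "int i" "int j"] BE[OF ij] AA[OF ij]
            unfolding s\<^sub>5 clipB by (simp add: clip_def B_def)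
          have \<beta>01: "s\<^sub>5 15 a = 0 \<or> s\<^sub>5 15 a = 1" for a
            unfolding s\<^sub>5 clipB by (simp add: clip_def)
          have \<gamma>: "s\<^sub>5 27 (int i * N + int j) = 0 \<longleftrightarrow>
              \<not> (\<exists>l<n. (\<exists>k<n. E i k \<and> E k l) \<and> (\<exists>k<n. E l k \<and> E k j))" if ij: "i < n" "j < n" for i j
          proof -
            have "s\<^sub>5 27 (int i * N + int j) = 0 \<longleftrightarrow> \<not> 0 < (B * B) $$ (i, j)"
              using BB[OF ij] mat01_square(1)[OF B B01 ij] by auto
            also have "\<dots> \<longleftrightarrow> \<not> (\<exists>l<n. B $$ (i, l) = 1 \<and> B $$ (l, j) = 1)"
              using mat01_square(3)[OF B B01 ij] by blast
            also have "\<dots> \<longleftrightarrow> \<not> (\<exists>l<n. (\<exists>k<n. E i k \<and> E k l) \<and> (\<exists>k<n. E l k \<and> E k j))"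
              by (simp add: BE ij cong: conj_cong)
            finally show ?thesis .
          qed
          have \<gamma>_bound: "0 \<le> s\<^sub>5 27 a \<and> s\<^sub>5 27 a \<le> N" if a: "0 \<le> a" "a < N * N" for a
          proof -
            obtain i j where ij: "i < n" "j < n" "a = int i * N + int j" using index_cases[OF a] .
            then show ?thesis using BB mat01_square(1,2)[OF B B01 ij(1,2)] by simp
          qed
          have \<alpha>': "s\<^sub>5 3 a = 0 \<or> s\<^sub>5 3 a = 1" for a using \<alpha> by (simp add: s\<^sub>5)
          have passes: "passes s\<^sub>5 (int i) (int j) \<longleftrightarrow> (E i j \<longleftrightarrow> E j i) \<and> (E i j \<longrightarrow> \<not> (\<exists>k<n. E i k \<and> E k j)) \<and>
              (i \<noteq> j \<longrightarrow> (g (int i * N + int j) = 1 \<longleftrightarrow> E i j \<or> (\<exists>k<n. E i k \<and> E k j))) \<and>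
              (E i j \<longrightarrow> \<not> (\<exists>l<n. (\<exists>k<n. E i k \<and> E k l) \<and> (\<exists>k<n. E l k \<and> E k j))) \<and>
              (E (nat v) j \<longleftrightarrow> U (int j) = 1)" if ij: "i < n" "j < n" for i j
          proof -
            have of_E: "s\<^sub>1 3 (int a * N + int b) = of_bool (E a b)" for a b
              using \<alpha>[of "int a * N + int b"] by (auto simp: E_def)
            have "s\<^sub>1 3 (v * N + int b) = of_bool (E (nat v) b)" for b
              using of_E[of "nat v" b] v by simp
            moreover define p q where "p = (\<exists>k<n. E i k \<and> E k j)"
              and "q = (\<exists>l<n. (\<exists>k<n. E i k \<and> E k l) \<and> (\<exists>k<n. E l k \<and> E k j))"
            ultimately show ?thesis
              using g01[of "int i * N + int j"] U01[of "int j"]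
              unfolding passes_def \<beta>[OF ij] \<gamma>[OF ij] s\<^sub>5(5) of_E p_def[symmetric] q_def[symmetric]
              by (cases "E i j"; cases "E j i"; cases p) auto
          qed
          have test: "(\<forall>i<n. \<forall>j<n. passes s\<^sub>5 (int i) (int j)) \<longleftrightarrow>
              root_test n (\<lambda>i j. g (int i * N + int j) = 1) (nat v) (\<lambda>j. U (int j) = 1) E"
            unfolding root_test_def by (simp only: passes cong: imp_cong)
          show "runs W check s\<^sub>5 (1 + 3 + (n * n + 1) * (cost check_body + 15)) ?Q"
          proof (rule runs_conseq[OF runs_check[OF s\<^sub>5(1-4) \<alpha>' \<beta>01 \<gamma>_bound]])
            fix s\<^sub>6 :: memory assume "s\<^sub>6 3 = s\<^sub>5 3 \<and> s\<^sub>6 4 0 = of_bool (\<forall>i<n. \<forall>j<n. passes s\<^sub>5 (int i) (int j))"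
            then have "s\<^sub>6 3 = s\<^sub>1 3" "s\<^sub>6 4 0 = of_bool (root_test n (\<lambda>i j. g (int i * N + int j) = 1) (nat v)
                (\<lambda>j. U (int j) = 1) E)"
              unfolding test by (simp_all add: s\<^sub>5)
            then show "?Q s\<^sub>6"
              using rows \<alpha> unfolding E_def by (simp add: row_ok_def)
          qed simp_all
        qed
      qed
    qed
  qed
qed

end

section \<open>Time, word size and the final assembly\<close>

text \<open>Positivity of \<open>n\<close> lets \<open>n * n\<close> absorb the linear and constant
  terms. The coefficients 409, 266 and 311 add up to less than 1000, so 10000 is generous.\<close>

lemma root_time_le:
  assumes "0 < n"
  shows "root_time n M \<le> 2 * M + 10000 * (n * n)"
proof -
  have "n \<le> n * n" "1 \<le> n * n" using assms by (simp_all add: Suc_le_eq)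
  moreover have "root_time n M = 2 * M + 409 + 266 * n + 311 * (n * n)"
    by (simp add: root_time_def search_time_def search_body_time_def expand_time_def row_body_def
        discover_body_def start_body_def copy_body_def support_body_def check_body_def penalty_def
        algebra_simps)
  ultimately show ?thesis by linarith
qed

lemma matrix_bank_index:
  assumes "i < n" "j < n"
  shows "matrix_bank n A (int i * int n + int j) = A $$ (i, j)"
proof -
  have "i * n + j < n * n"
  proof -
    have "(i + 1) * n \<le> n * n" using assms by (intro mult_right_mono) auto
    then show ?thesis using assms by simp
  qed
  moreover have "int i * int n + int j = int (i * n + j)" by simp
  ultimately show ?thesis
    using assms unfolding matrix_bank_def by (simp only: nat_int of_nat_less_iff) simp
qed

text \<open>Of eight factors \<open>n + 2\<close>, two provide the square, and the other six, each
  at least 2, provide the coefficient 64, which outweighs all coefficients required.\<close>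

lemma word_bound_large: "5 * (int n * int n) + 10 * int n + 50 \<le> word_bound (max k 8) n"
proof -
  have "(2 :: int) ^ 6 * (int n + 2) ^ 2 \<le> (int n + 2) ^ 6 * (int n + 2) ^ 2"
    by (intro mult_right_mono power_mono) auto
  also have "\<dots> = (int n + 2) ^ 8" by (simp flip: power_add)
  also have "\<dots> \<le> word_bound (max k 8) n"
    unfolding word_bound_def by (intro power_increasing) auto
  finally have "(2 :: int) ^ 6 * (int n + 2) ^ 2 \<le> word_bound (max k 8) n" .
  moreover have "(2 :: int) ^ 6 * (int n + 2) ^ 2 = 64 * (int n * int n) + 256 * int n + 256"
    by (simp add: power2_eq_square algebra_simps)
  moreover have "0 \<le> int n * int n" by simp
  ultimately show ?thesis by linarith
qed

text \<open>The arcs of a root form a candidate, so bank 3 contains its matrix and the test accepts.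
  Conversely, acceptance means that the graph read off from bank 3 is itself a root. The exponent
  \<open>max k 8\<close> serves the given program and the surrounding code alike.\<close>

lemma constructs_roots_root_prog:
  assumes mult: "multiplies_matrices d P M"
  shows "constructs_roots (root_prog P) (\<lambda>n. root_time n (M n))"
proof -
  obtain k where P: "\<And>n A B. A \<in> carrier_mat n n \<Longrightarrow> B \<in> carrier_mat n n \<Longrightarrow>
      \<forall>i<n. \<forall>j<n. \<bar>A $$ (i, j)\<bar> \<le> int n ^ d \<and> \<bar>B $$ (i, j)\<bar> \<le> int n ^ d \<Longrightarrow>
      \<exists>t s. exec (word_bound k n) P (mult_input n A B) t s \<and> t \<le> M n \<and> bank_holds n (A * B) (s 3)"
    using mult unfolding multiplies_matrices_def by blast
  show ?thesis
    unfolding constructs_roots_def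
  proof (rule exI[of _ "max k 8"], intro allI impI, elim conjE)
    fix n :: nat and G v U
    assume G: "pair_graph G" "pverts G = {..<n}" "Digraph_Component.connected (with_proj G)"
      and vG: "v \<in> pverts G" and U: "U \<subseteq> neighbourhood G v"
    define W where "W = word_bound (max k 8) n"
    define g where "g = matrix_bank n (adjacency_matrix n G)"
    define u where "u = (\<lambda>a. of_bool (0 \<le> a \<and> nat a \<in> U) :: int)"
    have vn: "v < n" using vG G(2) by simp
    have Un: "U \<subseteq> {..<n}"
      using U pair_graph_wfD(2)[OF G(1)] G(2) by (auto simp: neighbourhood_def)
    have g_arc: "g (int i * int n + int j) = of_bool ((i, j) \<in> parcs G)" if "i < n" "j < n" for i j
      using that by (simp add: g_def matrix_bank_index adjacency_matrix_def)
    have kW: "word_bound k n \<le> W"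
      unfolding W_def word_bound_def by (intro power_increasing) auto
    interpret search_instance n "int v" W g u
    proof
      show "5 * (int n * int n) + 10 * int n + 50 \<le> W" unfolding W_def by (rule word_bound_large)
      show "g a = 0 \<or> g a = 1" for a
        unfolding g_def matrix_bank_def adjacency_matrix_def
      proof (cases "0 \<le> a \<and> a < int (n * n)")
        case True
        then have "nat a < n * n" by (simp only: nat_less_iff)
        then have "nat a div n < n" "nat a mod n < n" using vn by (simp_all add: less_mult_imp_div_less)
        then show "(if 0 \<le> a \<and> a < int (n * n) then mat n n (\<lambda>(i, j). of_bool ((i, j) \<in> parcs G)) $$
            (nat a div n, nat a mod n) else 0) = (0 :: int) \<or> (if 0 \<le> a \<and> a < int (n * n) then
            mat n n (\<lambda>(i, j). of_bool ((i, j) \<in> parcs G)) $$ (nat a div n, nat a mod n) else 0) = (1 :: int)"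
          by simp
      qed auto
    qed (use vn in \<open>auto simp: u_def\<close>)
    let ?s = "root_input n G v U"
    have "safe ?s"
      unfolding safe_def using vn by (simp add: root_input_def g_def u_def)
    moreover have "?s 5 a = 0" "?s 6 a = 0" for a by (simp_all add: root_input_def)
    ultimately have "runs W (root_prog P) ?s (root_time n (M n))
        (\<lambda>s. (\<forall>R. candidate R \<longrightarrow> (\<forall>i<n. \<forall>j<n. s 3 (int i * int n + int j) = of_bool (R (int i) (int j)))) \<and>
           (\<forall>a. s 3 a = 0 \<or> s 3 a = 1) \<and>
           s 4 0 = of_bool (root_test n (\<lambda>i j. g (int i * int n + int j) = 1) (nat (int v))
             (\<lambda>j. u (int j) = 1) (\<lambda>i j. s 3 (int i * int n + int j) = 1)))"
      by (intro runs_root_prog[OF P kW])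
    then obtain t s where exec: "exec W (root_prog P) ?s t s" "t \<le> root_time n (M n)"
      and rows: "\<And>R i j. candidate R \<Longrightarrow> i < n \<Longrightarrow> j < n \<Longrightarrow>
        s 3 (int i * int n + int j) = of_bool (R (int i) (int j))"
      and flag: "s 4 0 = of_bool (root_test n (\<lambda>i j. g (int i * int n + int j) = 1) (nat (int v))
        (\<lambda>j. u (int j) = 1) (\<lambda>i j. s 3 (int i * int n + int j) = 1))"
      unfolding runs_def by blast
    define E where "E i j \<longleftrightarrow> s 3 (int i * int n + int j) = 1" for i j
    \<comment> \<open>The graph read off from bank 3, whether or not a root exists.\<close>
    define H\<^sub>0 where "H\<^sub>0 = \<lparr>pverts = {..<n}, parcs = {(i, j). i < n \<and> j < n \<and> E i j}\<rparr>"
    have "root_test n (\<lambda>i j. g (int i * int n + int j) = 1) (nat (int v)) (\<lambda>j. u (int j) = 1) E \<longleftrightarrow>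
        root_test n (\<lambda>i j. (i, j) \<in> parcs G) v (\<lambda>j. j \<in> U) E"
      unfolding root_test_def by (simp add: g_arc u_def)
    then have flag': "s 4 0 = of_bool (C3_C5_free_root_at G v U H\<^sub>0)"
      using flag root_iff_test[OF G(1,2) vn Un H\<^sub>0_def] unfolding E_def by simp
    have root: "H = H\<^sub>0 \<and> bank_holds n (adjacency_matrix n H) (s 3)" if H: "C3_C5_free_root_at G v U H" for H
    proof -
      have h: "pair_graph H" "\<not> has_cycle_of_length H 3" "\<not> has_cycle_of_length H 5"
        "graph_square H = G" "neighbourhood H v = U" using H by (auto simp: C3_C5_free_root_at_def)
      have Hn: "pverts H = {..<n}" using h(4) G(2) graph_square_verts by metis
      have arc_lt: "i < n" "j < n" if "(i, j) \<in> parcs H" for i j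
        using pair_graph_wfD[OF h(1) that] Hn by auto
      \<comment> \<open>The sign guards matter: \<open>nat\<close> sends negative integers to 0 and
        would create spurious arcs at vertex 0.\<close>
      define R where "R x y \<longleftrightarrow> 0 \<le> x \<and> 0 \<le> y \<and> (nat x, nat y) \<in> parcs H" for x y :: int
      have R_int: "R (int i) (int j) \<longleftrightarrow> (i, j) \<in> parcs H" for i j by (simp add: R_def)
      have RE: "\<exists>i j. x = int i \<and> y = int j \<and> (i, j) \<in> parcs H" if "R x y" for x y
        using that unfolding R_def by (metis nat_0_le)
      have "candidate R"
        unfolding candidate_def
      proof (intro conjI allI impI)
        fix x y assume "R x y"
        then obtain i j where ij: "x = int i" "y = int j" "(i, j) \<in> parcs H" using RE by blast
        then show "0 \<le> x" "x < int n" "0 \<le> y" "y < int n" "x \<noteq> y"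
          using arc_lt[OF ij(3)] pair_graph_irreflD[OF h(1)] by auto
      next
        fix x assume "0 \<le> x" "x < int n"
        then show "u x = of_bool (R (int v) x)"
          by (auto simp: u_def R_def neighbourhood_def simp flip: h(5))
      next
        fix p y x assume "R p y" and x: "0 \<le> x" "x < int n"
        then obtain i j where ij: "p = int i" "y = int j" "(i, j) \<in> parcs H" using RE by blast
        from x obtain l where l: "x = int l" "l < n" by (auto elim: nonneg_int_cases)
        show "R y x \<longleftrightarrow> x = p \<or> g (y * int n + x) = 1 \<and> g (p * int n + x) = 1 \<and> \<not> R p x"
          using root_neighbourhood[OF h(1-3) ij(3), of l] arc_lt[OF ij(3)] l(2)
          unfolding ij(1,2) l(1) h(4) R_int by (simp add: g_arc)
      next
        fix S assume "int v \<in> S" and closed: "\<forall>x\<in>S. \<forall>y. R x y \<longrightarrow> y \<in> S"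
        have "pverts G \<subseteq> {i. int i \<in> S}"
        proof (rule root_closed_set[OF G(3,1) vG _ H])
          show "v \<in> {i. int i \<in> S}" using \<open>int v \<in> S\<close> by simp
          show "j \<in> {i. int i \<in> S}" if "i \<in> {i. int i \<in> S}" "(i, j) \<in> parcs H" for i j
            using that closed R_int by blast
        qed
        then show "{0..<int n} \<subseteq> S"
          unfolding G(2) by (force elim!: nonneg_int_cases)
      qed
      from rows[OF this] have s3: "s 3 (int i * int n + int j) = of_bool ((i, j) \<in> parcs H)" if "i < n" "j < n" for i j
        using that by (simp add: R_int)
      have "parcs H = {(i, j). i < n \<and> j < n \<and> E i j}"
        using arc_lt s3 by (auto simp: E_def)
      then have "H = H\<^sub>0" using Hn by (simp add: H\<^sub>0_def)
      moreover have "bank_holds n (adjacency_matrix n H) (s 3)"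
        using s3 by (simp add: bank_holds_def adjacency_matrix_def)
      ultimately show ?thesis ..
    qed
    show "\<exists>t s. exec (word_bound (max k 8) n) (root_prog P) ?s t s \<and> t \<le> root_time n (M n) \<and>
        (\<forall>H. C3_C5_free_root_at G v U H \<longrightarrow> s 4 0 = 1 \<and> bank_holds n (adjacency_matrix n H) (s 3)) \<and>
        ((\<nexists>H. C3_C5_free_root_at G v U H) \<longrightarrow> s 4 0 = 0)"
      using exec root flag' unfolding W_def by (intro exI[of _ t] exI[of _ s]) auto
  qed
qed

theorem theorem3p2:
  shows "(\<forall>(G :: 'a pair_pre_digraph) v U.
            pair_graph G \<and> Digraph_Component.connected (with_proj G) \<and>
            v \<in> pverts G \<and> U \<subseteq> neighbourhood G v \<longrightarrow>
            (\<exists>\<^sub>\<le>\<^sub>1 H. C3_C5_free_root_at G v U H))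
       \<and> (\<forall>d P M. multiplies_matrices d P M \<longrightarrow>
            (\<exists>Q T. constructs_roots Q T \<and> (\<lambda>n. real (T n)) \<in> O(\<lambda>n. real (M n))))"
proof (intro conjI allI impI)
  fix G :: "'a pair_pre_digraph" and v U
  assume "pair_graph G \<and> Digraph_Component.connected (with_proj G) \<and>
            v \<in> pverts G \<and> U \<subseteq> neighbourhood G v"
  then show "\<exists>\<^sub>\<le>\<^sub>1 H. C3_C5_free_root_at G v U H"
    by (intro Uniq_I) (blast intro: root_unique)
next
  fix d P M assume mult: "multiplies_matrices d P M"
  have "(\<lambda>n. real (root_time n (M n))) \<in> O(\<lambda>n. real (M n))"
  \<comment> \<open>The constant combines the 2 for the multiplications with the 10000 for the
    quadratic part, as \<open>n * n \<le> M n\<close>. The value \<open>n = 0\<close> is left out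
    because \<open>root_time_le\<close> needs positive \<open>n\<close>.\<close>
  proof (rule bigoI[where c = 10002], rule eventually_mono[OF eventually_gt_at_top[of 0]])
    fix n :: nat assume "0 < n"
    then have "root_time n (M n) \<le> 2 * M n + 10000 * M n"
      using root_time_le[of n "M n"] square_le_multiplication_time[OF mult, of n] by linarith
    then have "real (root_time n (M n)) \<le> real (10002 * M n)" by (intro of_nat_mono) simp
    then show "norm (real (root_time n (M n))) \<le> 10002 * norm (real (M n))" by simp
  qed
  then show "\<exists>Q T. constructs_roots Q T \<and> (\<lambda>n. real (T n)) \<in> O(\<lambda>n. real (M n))"
    using constructs_roots_root_prog[OF mult] by blast
qed

end
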